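(* Let $1\le p<\infty$ and let $q$ be the conjugate exponent, $\frac1p+\frac1q=1$. Consider the delayed periodic system $$\frac{du_i}{dt}=-d_i(t)u_i(t)+\sum_{j=1}^n a_{ij}(t)g_j(u_j(t))+\sum_{j=1}^n b_{ij}(t)f_j(u_j(t-\tau_{ij}))+I_i(t),\quad i=1,\dots,n, \qquad (S)$$ with the standing assumptions on $d_i(t),a_{ij}(t),b_{ij}(t),I_i(t),\tau_{ij}$ given in the context. Suppose $g=(g_1,\dots,g_n)^T\in H\{G_1,\dots,G_n\}$ and $f=(f_1,\dots,f_n)^T\in H\{F_1,\dots,F_n\}$. Suppose there are real constants $\epsilon>0$, $\xi_i>0$, $\alpha_{ij}$, $\beta_{ij}$ ($i,j=1,\dots,n$) such that for every $i=1,\dots,n$ $$(-d_i+\epsilon)\xi_i+G_i\Big[\xi_i|a_{ii}^*|+\frac1p\sum_{j\ne i}\xi_j|a_{ji}^*|^{\alpha_{ji}p}\Big]+\frac1q\xi_i\sum_{j\ne i}G_j|a_{ij}^*|^{(1-\alpha_{ij})q}+\frac1pF_i\sum_{j=1}^n\xi_j|b_{ji}^*|^{\beta_{ji}p}e^{\epsilon\tau_{ji}}+\frac1q\xi_i\sum_{j=1}^nF_j|b_{ij}^*|^{(1-\beta_{ij})q}e^{\epsilon\tau_{ij}}\le 0 .$$ (In particular, taking $\alpha_{ij}=\beta_{ij}=\frac1p$, it suffices that for every $i$ $$(-d_i+\epsilon)\xi_i+G_i\Big[\xi_i|a_{ii}^*|+\frac1p\sum_{j\ne i}\xi_j|a_{ji}^*|\Big]+\frac1q\xi_i\sum_{j\ne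 i}G_j|a_{ij}^*|+\frac1pF_i\sum_{j=1}^n\xi_j|b_{ji}^*|e^{\epsilon\tau_{ji}}+\frac1q\xi_i\sum_{j=1}^nF_j|b_{ij}^*|e^{\epsilon\tau_{ij}}\le 0.)$$ Then the system $(S)$ has a unique $\omega$-periodic solution $v(t)=[v_1(t),\dots,v_n(t)]^T$, and for any solution $u(t)=[u_1(t),\dots,u_n(t)]^T$ of $(S)$, $$|u_i(t+j\omega)-v_i(t)|=O(e^{-j\epsilon\omega})\quad (j\to\infty),\qquad i=1,\dots,n .$$
   Context: Standing assumptions: $n\ge1$; $\omega>0$; $\tau_{ij}\ge 0$ are constants and $\tau=\max_{i,j}\tau_{ij}$; $d_i(t),a_{ij}(t),b_{ij}(t),I_i(t):\mathbf R^+\to\mathbf R$ are continuous and periodic with period $\omega$; $d_i(t)\ge d_i>0$ for all $t$, where $d_i$ are constants. Notation: $|a_{ij}^*|=\sup_{0<t\le\omega}|a_{ij}(t)|$, $|b_{ij}^*|=\sup_{0<t\le\omega}|b_{ij}(t)|$. A solution of $(S)$ is a continuous function $u$ on $[-\tau,\infty)$ satisfying $(S)$ for $t\ge 0$, with initial condition $u_i(s)=\phi_i(s)$ for $s\in[-\tau,0]$, $\phi_i\in C([-\tau,0])$ arbitrary. A periodic solution is a solution $v$ with $v(t+\omega)=v(t)$ for all $t\ge-\tau$. For constants $G_i>0$, a vector of functions $g=(g_1,\dots,g_n)^T$, $g_i:\mathbf R\to\mathbf R$, belongs to $H\{G_1,\dots,G_n\}$ if $\frac{|g_i(x+u)-g_i(x)|}{|u|}\le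 G_i$ for all $x\in\mathbf R$, $u\ne 0$, $i=1,\dots,n$. The functions are not assumed bounded. Convention for $p=1$: $\frac1q=0$, one takes $\alpha_{ij}=\beta_{ij}=1$, and the terms with the factor $\frac1q$ are absent. *)

theory Defs
  imports "HOL-Analysis.Analysis" "HOL-Library.Landau_Symbols"
begin

text \<open>Coefficients are functions on \<open>[0, \<infinity>)\<close>; their values at negative arguments are irrelevant.\<close>

definition periodic_coeff :: "real \<Rightarrow> (real \<Rightarrow> real) \<Rightarrow> bool" where
  "periodic_coeff \<omega> h \<longleftrightarrow> continuous_on {0..} h \<and> (\<forall>t\<ge>0. h (t + \<omega>) = h t)"

definition sup_abs :: "real \<Rightarrow> (real \<Rightarrow> real) \<Rightarrow> real" where
  "sup_abs \<omega> h = (SUP t\<in>{0<..\<omega>}. \<bar>h t\<bar>)"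

definition H_class :: "('n \<Rightarrow> real) \<Rightarrow> ('n \<Rightarrow> real \<Rightarrow> real) \<Rightarrow> bool" where
  "H_class G g \<longleftrightarrow> (\<forall>i x u. u \<noteq> 0 \<longrightarrow> \<bar>g i (x + u) - g i x\<bar> / \<bar>u\<bar> \<le> G i)"

definition max_delay :: "('n::finite \<Rightarrow> 'n \<Rightarrow> real) \<Rightarrow> real" where
  "max_delay \<tau> = Max (range (\<lambda>(i, j). \<tau> i j))"

text \<open>
  The initial function of a solution is its restriction to \<open>[- max_delay \<tau>, 0]\<close>, which may be any
  continuous function. Values to the left of \<open>- max_delay \<tau>\<close> are irrelevant. The derivative is
  two-sided for \<open>t > 0\<close> and the right derivative at \<open>t = 0\<close>.
\<close>

definition solution ::
  "('n::finite \<Rightarrow> real \<Rightarrow> real) \<Rightarrow> ('n \<Rightarrow> 'n \<Rightarrow> real \<Rightarrow> real) \<Rightarrow> ('n \<Rightarrow> 'n \<Rightarrow> real \<Rightarrow> real) \<Rightarrow>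
   ('n \<Rightarrow> real \<Rightarrow> real) \<Rightarrow> ('n \<Rightarrow> 'n \<Rightarrow> real) \<Rightarrow> ('n \<Rightarrow> real \<Rightarrow> real) \<Rightarrow> ('n \<Rightarrow> real \<Rightarrow> real) \<Rightarrow>
   (real \<Rightarrow> real ^ 'n) \<Rightarrow> bool" where
  "solution d a b I \<tau> g f u \<longleftrightarrow>
     continuous_on {- max_delay \<tau>..} u \<and>
     (\<forall>t\<ge>0. \<forall>i. ((\<lambda>s. u s $ i) has_real_derivative
        (- d i t * u t $ i
         + (\<Sum>j\<in>UNIV. a i j t * g j (u t $ j))
         + (\<Sum>j\<in>UNIV. b i j t * f j (u (t - \<tau> i j) $ j))
         + I i t)) (at t within {0..}))"

definition periodic_solution ::
  "real \<Rightarrow> ('n::finite \<Rightarrow> real \<Rightarrow> real) \<Rightarrow> ('n \<Rightarrow> 'n \<Rightarrow> real \<Rightarrow> real) \<Rightarrow> ('n \<Rightarrow> 'n \<Rightarrow> real \<Rightarrow> real) \<Rightarrow>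
   ('n \<Rightarrow> real \<Rightarrow> real) \<Rightarrow> ('n \<Rightarrow> 'n \<Rightarrow> real) \<Rightarrow> ('n \<Rightarrow> real \<Rightarrow> real) \<Rightarrow> ('n \<Rightarrow> real \<Rightarrow> real) \<Rightarrow>
   (real \<Rightarrow> real ^ 'n) \<Rightarrow> bool" where
  "periodic_solution \<omega> d a b I \<tau> g f v \<longleftrightarrow>
     solution d a b I \<tau> g f v \<and> (\<forall>t\<ge>- max_delay \<tau>. v (t + \<omega>) = v t)"

text \<open>
  The left-hand side of the stability inequality for index \<open>i\<close>. Here \<open>A i j\<close> and \<open>B i j\<close> stand for
  the suprema \<open>\<bar>a\<^sub>i\<^sub>j\<^sup>*\<bar>\<close> and \<open>\<bar>b\<^sub>i\<^sub>j\<^sup>*\<bar>\<close>, and \<open>\<delta>\<close> for the lower bounds of the decay rates.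
  For \<open>p = 1\<close> the conjugate exponent is infinite and the terms with factor \<open>1 / q\<close> are dropped.
  Since \<open>0 powr x = 0\<close> for every \<open>x\<close>, a vanishing coefficient contributes nothing, even if its
  exponent is zero or negative.
\<close>

definition stability_lhs ::
  "real \<Rightarrow> real \<Rightarrow> ('n::finite \<Rightarrow> real) \<Rightarrow> ('n \<Rightarrow> 'n \<Rightarrow> real) \<Rightarrow> ('n \<Rightarrow> 'n \<Rightarrow> real) \<Rightarrow>
   ('n \<Rightarrow> 'n \<Rightarrow> real) \<Rightarrow> ('n \<Rightarrow> real) \<Rightarrow> ('n \<Rightarrow> real) \<Rightarrow> real \<Rightarrow> ('n \<Rightarrow> real) \<Rightarrow>
   ('n \<Rightarrow> 'n \<Rightarrow> real) \<Rightarrow> ('n \<Rightarrow> 'n \<Rightarrow> real) \<Rightarrow> 'n \<Rightarrow> real" where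
  "stability_lhs p q \<delta> A B \<tau> G F \<epsilon> \<xi> \<alpha> \<beta> i =
     (- \<delta> i + \<epsilon>) * \<xi> i
     + G i * (\<xi> i * A i i + 1 / p * (\<Sum>j\<in>UNIV - {i}. \<xi> j * A j i powr (\<alpha> j i * p)))
     + (if p = 1 then 0
        else 1 / q * \<xi> i * (\<Sum>j\<in>UNIV - {i}. G j * A i j powr ((1 - \<alpha> i j) * q)))
     + 1 / p * F i * (\<Sum>j\<in>UNIV. \<xi> j * B j i powr (\<beta> j i * p) * exp (\<epsilon> * \<tau> j i))
     + (if p = 1 then 0
        else 1 / q * \<xi> i *
          (\<Sum>j\<in>UNIV. F j * B i j powr ((1 - \<beta> i j) * q) * exp (\<epsilon> * \<tau> i j)))"

text \<open>The special case \<open>\<alpha>\<^sub>i\<^sub>j = \<beta>\<^sub>i\<^sub>j = 1 / p\<close>, in which all exponents become 1.\<close>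

definition stability_lhs_special ::
  "real \<Rightarrow> real \<Rightarrow> ('n::finite \<Rightarrow> real) \<Rightarrow> ('n \<Rightarrow> 'n \<Rightarrow> real) \<Rightarrow> ('n \<Rightarrow> 'n \<Rightarrow> real) \<Rightarrow>
   ('n \<Rightarrow> 'n \<Rightarrow> real) \<Rightarrow> ('n \<Rightarrow> real) \<Rightarrow> ('n \<Rightarrow> real) \<Rightarrow> real \<Rightarrow> ('n \<Rightarrow> real) \<Rightarrow> 'n \<Rightarrow> real" where
  "stability_lhs_special p q \<delta> A B \<tau> G F \<epsilon> \<xi> i =
     (- \<delta> i + \<epsilon>) * \<xi> i
     + G i * (\<xi> i * A i i + 1 / p * (\<Sum>j\<in>UNIV - {i}. \<xi> j * A j i))
     + (if p = 1 then 0 else 1 / q * \<xi> i * (\<Sum>j\<in>UNIV - {i}. G j * A i j))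
     + 1 / p * F i * (\<Sum>j\<in>UNIV. \<xi> j * B j i * exp (\<epsilon> * \<tau> j i))
     + (if p = 1 then 0 else 1 / q * \<xi> i * (\<Sum>j\<in>UNIV. F j * B i j * exp (\<epsilon> * \<tau> i j)))"

end

theory Submission
  imports Defs
begin

text \<open>The whole theorem rests on one estimate: any two solutions \<open>u\<close>, \<open>w\<close> of the system satisfy
\<open>\<bar>u\<^sub>i t - w\<^sub>i t\<bar> \<le> C exp (- \<epsilon> t)\<close> (\<open>solutions_converge\<close>). Put \<open>z\<^sub>i t = exp (\<epsilon> t) \<bar>u\<^sub>i t - w\<^sub>i t\<bar>\<close>.
Young's inequality, split by the exponents \<open>\<alpha>\<close> and \<open>\<beta>\<close>, turns each mixed term
\<open>z\<^sub>i powr (p - 1) * z\<^sub>j\<close> in the growth rate of \<open>z\<^sub>i powr p\<close> into separate multiples of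
\<open>z\<^sub>i powr p\<close> and \<open>z\<^sub>j powr p\<close>. Delayed values of \<open>z\<^sub>j powr p\<close> are absorbed by adding
integrals over the delay window. With \<open>R\<^sub>i\<^sub>j\<close> the weight that Young's inequality gives to the delayed
power, the Lyapunov functional is
\<open>V t = (\<Sum>i. \<xi>\<^sub>i z\<^sub>i(t)\<^sup>p) + p (\<Sum>i j. \<xi>\<^sub>i F\<^sub>j exp (\<epsilon> \<tau>\<^sub>i\<^sub>j) R\<^sub>i\<^sub>j \<integral> z\<^sub>j\<^sup>p over [t - \<tau>\<^sub>i\<^sub>j, t])\<close>.
After exchanging the order of summation, the rate of \<open>V\<close> is bounded by \<open>p\<close> times the sum over \<open>i\<close>
of \<open>z\<^sub>i powr p\<close> times the left-hand side of the \<open>i\<close>-th stability inequality. So \<open>V\<close> does not increase,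
and every \<open>z\<^sub>i\<close> stays bounded. The second form of the stability inequality is the first with all
exponents \<open>\<alpha>\<close>, \<open>\<beta>\<close> equal to \<open>1 / p\<close>.

The absolute value is not differentiable at \<open>0\<close>, and for \<open>p = 1\<close> taking the power does not repair
this. It does have a right derivative wherever its argument has one, and a continuous function with
nonpositive right derivatives does not increase; so right derivatives are used throughout.

The periodic solution comes from the same estimate without a Poincare map. Since the
coefficients are periodic, \<open>t \<mapsto> u (t + k \<omega>)\<close> is again a solution. Comparing \<open>u\<close> with its shift by
one period shows that consecutive shifts differ by \<open>O(exp (- k \<epsilon> \<omega>))\<close> uniformly on
\<open>[- r, \<infinity>)\<close>, where \<open>r\<close> is the maximal delay. The shifts therefore converge uniformly. The limit
is periodic, and it is a solution because the right-hand side of the system is Lipschitz with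
respect to the history. Uniqueness and the rate of attraction are the estimate again. A solution
\<open>u\<close> to start from exists by a contraction argument (\<open>ex_causal_lipschitz_solution\<close>).\<close>

section \<open>Right derivatives and Young's inequality\<close>

text \<open>If \<open>V\<close> ended above its starting value, it would still do so after subtracting a line of small
positive slope. Past the last point where the tilted function is nonpositive it would have to be
positive, but its right derivative there is negative.\<close>

lemma right_derivative_nonpos_imp_le:
  fixes V :: "real \<Rightarrow> real"
  assumes "a \<le> b" and cont: "continuous_on {a..b} V"
    and der: "\<And>t. a \<le> t \<Longrightarrow> t < b \<Longrightarrow>
      \<exists>D\<le>0. (V has_real_derivative D) (at t within {t..})"
  shows "V b \<le> V a"
proof (rule ccontr)
  assume "\<not> V b \<le> V a"
  then have less: "V a < V b" by simp
  with \<open>a \<le> b\<close> have "a < b" by (cases "a = b") auto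
  \<comment> \<open>half the slope of the chord of \<open>V\<close>, so that the tilted function is still positive at \<open>b\<close>\<close>
  define e where "e = (V b - V a) / (2 * (b - a))"
  have "e > 0" using less \<open>a < b\<close> by (simp add: e_def)
  define \<phi> where "\<phi> t = V t - V a - e * (t - a)" for t
  have "\<phi> b = (V b - V a) / 2"
    using \<open>a < b\<close> by (simp add: \<phi>_def e_def field_simps)
  then have "\<phi> b > 0" using less by simp
  define S where "S = {a..b} \<inter> \<phi> -` {..0}"
  have cphi: "continuous_on {a..b} \<phi>"
    unfolding \<phi>_def by (intro continuous_intros cont)
  have "closed S"
    unfolding S_def by (intro continuous_closed_preimage cphi) auto
  moreover have "bounded S"
    unfolding S_def by (meson bounded_Int bounded_closed_interval)
  ultimately have "compact S" by (simp add: compact_eq_bounded_closed)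
  moreover have "a \<in> S" using \<open>a \<le> b\<close> by (simp add: S_def \<phi>_def)
  ultimately obtain c where c: "c \<in> S" and cmax: "\<And>t. t \<in> S \<Longrightarrow> t \<le> c"
    using compact_attains_sup[of S] by blast
  have "a \<le> c" "c < b" "\<phi> c \<le> 0"
    using c \<open>\<phi> b > 0\<close> by (auto simp: S_def order_le_less)
  obtain D where "D \<le> 0" and D: "(V has_real_derivative D) (at c within {c..})"
    using der[OF \<open>a \<le> c\<close> \<open>c < b\<close>] by blast
  have "(\<phi> has_real_derivative D - e) (at c within {c..})"
    unfolding \<phi>_def by (auto intro!: derivative_eq_intros D)
  from has_real_derivative_neg_dec_right[OF this] obtain \<eta>
    where "\<eta> > 0" and \<eta>: "\<And>h. 0 < h \<Longrightarrow> h < \<eta> \<Longrightarrow> \<phi> (c + h) < \<phi> c"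
    using \<open>D \<le> 0\<close> \<open>e > 0\<close> by auto
  define h where "h = min (\<eta> / 2) (b - c)"
  have "0 < h" "h < \<eta>" "c + h \<le> b"
    using \<open>\<eta> > 0\<close> \<open>c < b\<close> by (auto simp: h_def)
  with \<eta>[of h] \<open>\<phi> c \<le> 0\<close> \<open>a \<le> c\<close> have "c + h \<in> S" by (auto simp: S_def)
  with cmax \<open>0 < h\<close> show False by fastforce
qed

text \<open>At a zero of \<open>x\<close> only \<open>s > t\<close> matters, where the difference quotient of \<open>\<bar>x\<bar>\<close> is the absolute
value of the difference quotient of \<open>x\<close>.\<close>

lemma abs_has_right_derivative:
  fixes x :: "real \<Rightarrow> real"
  assumes x: "(x has_real_derivative x') (at t within {t..})"
  shows "((\<lambda>s. \<bar>x s\<bar>) has_real_derivative (if x t = 0 then \<bar>x'\<bar> else sgn (x t) * x'))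
           (at t within {t..})"
proof (cases "x t = 0")
  case True
  have "((\<lambda>s. (x s - x t) / (s - t)) \<longlongrightarrow> x') (at t within {t..})"
    using x by (simp add: has_field_derivative_iff)
  then have lim: "((\<lambda>s. \<bar>(x s - x t) / (s - t)\<bar>) \<longlongrightarrow> \<bar>x'\<bar>) (at t within {t..})"
    by (rule tendsto_rabs)
  have "\<forall>\<^sub>F s in at t within {t..}. s \<in> {t..} \<and> s \<noteq> t"
    by (simp add: eventually_at_filter)
  then have "\<forall>\<^sub>F s in at t within {t..}.
      \<bar>(x s - x t) / (s - t)\<bar> = (\<bar>x s\<bar> - \<bar>x t\<bar>) / (s - t)"
    by eventually_elim (simp add: True)
  from Lim_transform_eventually[OF lim this] show ?thesis
    unfolding has_field_derivative_iff using True by simp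
next
  case False
  have "(abs has_real_derivative sgn (x t)) (at (x t))"
    using GDERIV_norm[OF False]
    by (simp add: gderiv_def has_field_derivative_def mult_commute_abs abs_real_def[abs_def] real_norm_def[abs_def])
  from DERIV_chain2[OF this x] False False show ?thesis by simp
qed

text \<open>The case distinction gives the factor \<open>z powr (p - 1)\<close> the value \<open>1\<close> for \<open>p = 1\<close> also at \<open>z = 0\<close>,
where \<open>0 powr 0 = 0\<close> would be wrong.\<close>

lemma powr_has_right_derivative:
  fixes z :: "real \<Rightarrow> real"
  assumes "1 \<le> p" and z: "(z has_real_derivative z') (at t within {t..})"
    and nonneg: "\<And>s. t \<le> s \<Longrightarrow> 0 \<le> z s"
  shows "((\<lambda>s. z s powr p) has_real_derivative
           p * (if p = 1 then 1 else z t powr (p - 1)) * z') (at t within {t..})"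
proof -
  consider "p = 1" | "p > 1" "z t > 0" | "p > 1" "z t = 0"
    using \<open>1 \<le> p\<close> nonneg[of t] by fastforce
  then show ?thesis
  proof cases
    case 1
    show ?thesis
      by (rule has_field_derivative_transform_within[OF _ zero_less_one, where f = z])
        (use 1 z nonneg in \<open>auto simp: powr_one\<close>)
  next
    case 2
    have "((\<lambda>s. s powr p) has_real_derivative p * z t powr (p - 1)) (at (z t))"
      using 2 by (auto intro!: has_real_derivative_powr)
    from DERIV_chain2[OF this z] show ?thesis using 2 by simp
  next
    case 3
    \<comment> \<open>at a zero of \<open>z\<close>, one factor \<open>z\<close> forms the difference quotient and the others vanish in the limit\<close>
    have "((\<lambda>s. z s powr (p - 1)) \<longlongrightarrow> z t powr (p - 1)) (at t within {t..})"
      by (rule tendsto_powr2) (use 3 z nonneg in \<open>auto simp: eventually_at_filter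
          dest!: DERIV_isCont has_field_derivative_imp_has_derivative
            has_derivative_continuous simp: continuous_within\<close>)
    moreover have "((\<lambda>s. (z s - z t) / (s - t)) \<longlongrightarrow> z') (at t within {t..})"
      using z by (simp add: has_field_derivative_iff)
    ultimately have lim: "((\<lambda>s. z s powr (p - 1) * ((z s - z t) / (s - t))) \<longlongrightarrow> 0)
        (at t within {t..})"
      using tendsto_mult 3 by fastforce
    have "z s powr p = z s powr (p - 1) * z s" if "t \<le> s" for s
      using nonneg[OF that] by (cases "z s = 0") (auto simp: powr_diff)
    then have "\<forall>\<^sub>F s in at t within {t..}.
        z s powr (p - 1) * ((z s - z t) / (s - t)) = (z s powr p - z t powr p) / (s - t)"
      using 3 by (auto simp: eventually_at_filter)
    from Lim_transform_eventually[OF lim this] show ?thesis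
      unfolding has_field_derivative_iff using 3 by simp
  qed
qed

text \<open>Young's inequality for the factors \<open>A powr \<alpha> * y\<close> and \<open>A powr (1 - \<alpha>) * x powr (p - 1)\<close>: the
exponent \<open>\<alpha>\<close> decides how the weight \<open>A\<close> is shared between the two powers, and
\<open>(p - 1) * q = p\<close>. For \<open>p = 1\<close> there is nothing to split and the whole weight goes to \<open>y\<close>.\<close>

lemma Young_powr:
  fixes A x y :: real
  assumes "1 \<le> p" and conj: "p \<noteq> 1 \<Longrightarrow> 1 / p + 1 / q = 1"
    and \<alpha>: "p = 1 \<Longrightarrow> \<alpha> = 1" and "0 \<le> A" "0 \<le> x" "0 \<le> y"
  shows "(if p = 1 then 1 else x powr (p - 1)) * (A * y) \<le>
      1 / p * A powr (\<alpha> * p) * y powr p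
      + (if p = 1 then 0 else 1 / q * A powr ((1 - \<alpha>) * q)) * x powr p"
proof (cases "p = 1")
  case True
  with assms show ?thesis by (simp add: powr_one)
next
  case False
  with \<open>1 \<le> p\<close> have "p > 1" by simp
  have "1 / q = 1 - 1 / p" using conj[OF False] by simp
  then have "1 / q > 0" "1 / q < 1" using \<open>p > 1\<close> by auto
  then have "q > 1" by (auto simp: field_simps zero_less_divide_iff split: if_splits)
  have pq: "(p - 1) * q = p"
    using conj[OF False] \<open>p > 1\<close> \<open>q > 1\<close> by (simp add: field_simps)
  show ?thesis
  proof (cases "A = 0")
    case True
    with \<open>p > 1\<close> show ?thesis by simp
  next
    case False
    with \<open>0 \<le> A\<close> have "A > 0" by simp
    have "(A powr \<alpha> * y) * (A powr (1 - \<alpha>) * x powr (p - 1))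
        \<le> (A powr \<alpha> * y) powr p / p + (A powr (1 - \<alpha>) * x powr (p - 1)) powr q / q"
      using \<open>p > 1\<close> \<open>q > 1\<close> conj assms by (intro Youngs_inequality) auto
    also have "(A powr \<alpha> * y) powr p / p = 1 / p * A powr (\<alpha> * p) * y powr p"
      using \<open>0 \<le> y\<close> by (simp add: powr_mult powr_powr)
    also have "(A powr (1 - \<alpha>) * x powr (p - 1)) powr q / q
        = 1 / q * A powr ((1 - \<alpha>) * q) * x powr p"
      by (simp add: powr_mult powr_powr pq)
    also have "(A powr \<alpha> * y) * (A powr (1 - \<alpha>) * x powr (p - 1))
        = A powr (\<alpha> + (1 - \<alpha>)) * (x powr (p - 1) * y)"
      by (simp only: powr_add) (simp add: mult_ac)
    finally show ?thesis using \<open>A > 0\<close> \<open>p \<noteq> 1\<close> by (simp add: mult_ac powr_one)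
  qed
qed

section \<open>Global solutions of causal Lipschitz equations\<close>

text \<open>The operator \<open>\<Phi>\<close> is causal: the bound on \<open>\<Phi> x t - \<Phi> y t\<close> involves the
arguments up to time \<open>t\<close> only. In the norm weighted by \<open>exp (- L t)\<close>, integrating a
\<open>K\<close>-Lipschitz right-hand side has Lipschitz constant \<open>K / L\<close>. So for \<open>L > K\<close> the
integral operator is a contraction on the whole half-line at once, and its fixed point is
a global solution. The weight is carried by the substitution \<open>x = E * y\<close> with \<open>y\<close> a
bounded continuous function; the solution obtained vanishes for \<open>t \<le> 0\<close>.\<close>

lemma ex_causal_lipschitz_solution:
  fixes \<Phi> :: "(real \<Rightarrow> 'a::euclidean_space) \<Rightarrow> real \<Rightarrow> 'a"
  assumes cont: "\<And>x. continuous_on UNIV x \<Longrightarrow> continuous_on {0..} (\<Phi> x)"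
    and lip: "\<And>x y t m. 0 \<le> t \<Longrightarrow> (\<And>s. s \<le> t \<Longrightarrow> norm (x s - y s) \<le> m) \<Longrightarrow>
        norm (\<Phi> x t - \<Phi> y t) \<le> K * m"
    and bound: "\<And>t. 0 \<le> t \<Longrightarrow> norm (\<Phi> (\<lambda>_. 0) t) \<le> C"
    and "0 \<le> K"
  shows "\<exists>x. continuous_on UNIV x \<and>
    (\<forall>t\<ge>0. (x has_vector_derivative \<Phi> x t) (at t within {0..}))"
proof -
  define L where "L = 2 * K + 1"
  have "L > 0" using \<open>0 \<le> K\<close> by (simp add: L_def)
  have "C \<ge> 0" using bound[of 0] norm_ge_zero[of "\<Phi> (\<lambda>_. 0) 0"] by linarith
  define E where "E s = exp (L * max s 0)" for s :: real
  have E_pos: "E s > 0" for s by (simp add: E_def)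
  have E_mono: "E s \<le> E t" if "s \<le> t" for s t
    using that \<open>L > 0\<close> by (auto simp: E_def)
  have E_ge1: "E s \<ge> 1" for s using \<open>L > 0\<close> by (simp add: E_def)
  have E_cont: "continuous_on S E" for S unfolding E_def by (intro continuous_intros)
  \<comment> \<open>integrating the weight gains the factor \<open>1 / L\<close>\<close>
  have E_int: "(E has_integral (E t - 1) / L) {0..t}" if "0 \<le> t" for t
  proof -
    have "((\<lambda>s. exp (L * s)) has_integral exp (L * t) / L - exp (L * 0) / L) {0..t}"
      using that \<open>L > 0\<close>
      by (intro fundamental_theorem_of_calculus)
        (auto intro!: derivative_eq_intros simp: has_real_derivative_iff_has_vector_derivative[symmetric])
    also have "exp (L * t) / L - exp (L * 0) / L = (E t - 1) / L"
      using that by (simp add: E_def diff_divide_distrib)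
    finally show ?thesis
      by (rule has_integral_eq[rotated]) (auto simp: E_def)
  qed
  define X where "X y s = E s *\<^sub>R apply_bcontfun y s" for y :: "real \<Rightarrow>\<^sub>C 'a" and s
  have X_cont: "continuous_on UNIV (X y)" for y
    unfolding X_def by (intro continuous_intros E_cont) simp
  have \<Phi>X_cont: "continuous_on {0..} (\<Phi> (X y))" for y using cont[OF X_cont] .
  have \<Phi>X_int: "\<Phi> (X y) integrable_on {0..t}" for y t
    by (rule integrable_continuous_real, rule continuous_on_subset[OF \<Phi>X_cont]) auto
  define J where "J y t = integral {0..t} (\<Phi> (X y))" for y t
  have J_deriv: "(J y has_vector_derivative \<Phi> (X y) t) (at t within {0..})" if "0 \<le> t" for y t
  proof -
    have "(J y has_vector_derivative \<Phi> (X y) t) (at t within {0..t+1})"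
      unfolding J_def using that
      by (intro integral_has_vector_derivative continuous_on_subset[OF \<Phi>X_cont]) auto
    moreover have "at t within {0..t+1} = at t within {0..}"
      by (rule at_within_nhd[of t "{t-1<..<t+1}"]) auto
    ultimately show ?thesis by simp
  qed
  define T where "T y t = J y (max t 0) /\<^sub>R E t" for y t
  have J_cont: "continuous_on {0..} (J y)" for y
    using J_deriv by (intro continuous_on_vector_derivative) auto
  have T_cont: "continuous_on UNIV (T y)" for y
  proof -
    have "continuous_on UNIV (J y \<circ> (\<lambda>t. max t 0))"
      by (intro continuous_on_compose continuous_intros continuous_on_subset[OF J_cont]) auto
    then show ?thesis
      unfolding T_def by (intro continuous_intros E_cont) (use E_pos in \<open>auto simp: o_def less_imp_neq[symmetric]\<close>)
  qed
  have J_bound: "norm (J y t) \<le> (C + K * norm y) / L * E t" if "0 \<le> t" for y t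
  proof -
    have "norm (\<Phi> (X y) s) \<le> (C + K * norm y) * E s" if "0 \<le> s" for s
    proof -
      have "norm (X y r - 0) \<le> norm y * E s" if "r \<le> s" for r
        using mult_mono[OF E_mono[OF that] norm_bounded[of y r]] E_pos[of s] E_pos[of r]
        by (simp add: X_def mult.commute)
      from lip[OF \<open>0 \<le> s\<close> this]
      have "norm (\<Phi> (X y) s - \<Phi> (\<lambda>_. 0) s) \<le> K * (norm y * E s)" by simp
      moreover have "C \<le> C * E s" using E_ge1[of s] \<open>C \<ge> 0\<close> by (simp add: mult_le_cancel_left1)
      ultimately show ?thesis
        using bound[OF \<open>0 \<le> s\<close>] norm_triangle_sub[of "\<Phi> (X y) s" "\<Phi> (\<lambda>_. 0) s"]
        by (simp add: algebra_simps)
    qed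
    then have "norm (J y t) \<le> integral {0..t} (\<lambda>s. (C + K * norm y) * E s)"
      unfolding J_def using E_int[OF that, THEN has_integral_integrable]
      by (intro integral_norm_bound_integral \<Phi>X_int) (auto intro!: integrable_on_mult_right)
    also have "\<dots> = (C + K * norm y) * ((E t - 1) / L)"
      using integral_unique[OF E_int[OF that]] by simp
    also have "\<dots> \<le> (C + K * norm y) * (E t / L)"
      using \<open>C \<ge> 0\<close> \<open>0 \<le> K\<close> \<open>L > 0\<close>
      by (intro mult_left_mono divide_right_mono) auto
    finally show ?thesis by simp
  qed
  have J_lip: "norm (J y t - J y' t) \<le> K * dist y y' / L * E t" if "0 \<le> t" for y y' t
  proof -
    have "norm (\<Phi> (X y) s - \<Phi> (X y') s) \<le> (K * dist y y') * E s" if "0 \<le> s" for s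
    proof -
      have "norm (X y r - X y' r) \<le> dist y y' * E s" if "r \<le> s" for r
      proof -
        have "norm (X y r - X y' r) = E r * dist (apply_bcontfun y r) (apply_bcontfun y' r)"
          using E_pos[of r] by (simp add: X_def dist_norm flip: scaleR_diff_right)
        also have "\<dots> \<le> E s * dist y y'"
          using E_mono[OF that] E_pos[of s] by (intro mult_mono dist_bounded) auto
        finally show ?thesis by (simp add: mult.commute)
      qed
      from lip[OF \<open>0 \<le> s\<close> this] show ?thesis by (simp add: mult.assoc)
    qed
    then have "norm (integral {0..t} (\<lambda>s. \<Phi> (X y) s - \<Phi> (X y') s))
        \<le> integral {0..t} (\<lambda>s. (K * dist y y') * E s)"
      using E_int[OF that, THEN has_integral_integrable]
      by (intro integral_norm_bound_integral integrable_diff \<Phi>X_int)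
        (auto intro!: integrable_on_mult_right)
    also have "\<dots> = (K * dist y y') * ((E t - 1) / L)"
      using integral_unique[OF E_int[OF that]] by simp
    also have "\<dots> \<le> (K * dist y y') * (E t / L)"
      using \<open>0 \<le> K\<close> \<open>L > 0\<close> by (intro mult_left_mono divide_right_mono) auto
    finally show ?thesis by (simp add: J_def integral_diff[OF \<Phi>X_int \<Phi>X_int])
  qed
  have T_bound: "norm (T y t) \<le> (C + K * norm y) / L" for y t
    using J_bound[of "max t 0" y] E_pos[of t] by (simp add: T_def E_def field_simps)
  have T_bcontfun: "T y \<in> bcontfun" for y
    by (rule bcontfun_normI[OF T_cont T_bound])
  have T_apply: "apply_bcontfun (Bcontfun (T y)) = T y" for y
    by (rule Bcontfun_inverse[OF T_bcontfun])
  have T_lip: "dist (Bcontfun (T y)) (Bcontfun (T y')) \<le> K / L * dist y y'" for y y'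
  proof (rule dist_bound)
    fix t
    have "dist (T y t) (T y' t) = norm (J y (max t 0) - J y' (max t 0)) / E t"
      using E_pos[of t] by (simp add: T_def dist_norm divide_inverse_commute flip: scaleR_diff_right)
    also have "\<dots> \<le> K / L * dist y y'"
      using J_lip[of "max t 0" y y'] E_pos[of t] by (simp add: E_def field_simps)
    finally show "dist (apply_bcontfun (Bcontfun (T y)) t) (apply_bcontfun (Bcontfun (T y')) t)
        \<le> K / L * dist y y'"
      by (simp add: T_apply)
  qed
  have "\<exists>!y. Bcontfun (T y) = y"
    using T_lip \<open>0 \<le> K\<close> by (intro banach_fix_type[of "K / L"]) (auto simp: L_def)
  then obtain y where "Bcontfun (T y) = y" by blast
  then have "apply_bcontfun y = T y" using T_apply by metis
  then have X_eq: "X y t = J y (max t 0)" for t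
    using E_pos[of t] by (simp add: X_def T_def)
  have "(X y has_vector_derivative \<Phi> (X y) t) (at t within {0..})" if "0 \<le> t" for t
    by (rule has_vector_derivative_transform[OF _ _ J_deriv[OF that]]) (use that X_eq in auto)
  with X_cont show ?thesis by blast
qed

section \<open>Periodic coefficients and Lipschitz classes\<close>

lemma periodic_coeff_add_multiple:
  assumes "periodic_coeff \<omega> h" "0 < \<omega>" "0 \<le> t"
  shows "h (t + real k * \<omega>) = h t"
proof (induction k)
  case (Suc k)
  have "h (t + real k * \<omega> + \<omega>) = h (t + real k * \<omega>)"
    using assms by (simp add: periodic_coeff_def)
  with Suc show ?case by (simp add: algebra_simps)
qed simp

text \<open>The supremum is taken over the half-open period \<open>(0, \<omega>]\<close>, so a time \<open>t > 0\<close> has to be moved into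
it by \<open>\<lceil>t / \<omega>\<rceil> - 1\<close> periods, and \<open>t = 0\<close> is moved to \<open>\<omega>\<close>.\<close>

lemma abs_le_sup_abs:
  assumes h: "periodic_coeff \<omega> h" and "0 < \<omega>" "0 \<le> t"
  shows "\<bar>h t\<bar> \<le> sup_abs \<omega> h"
proof -
  have "compact ((\<lambda>t. \<bar>h t\<bar>) ` {0..\<omega>})"
    using h by (intro compact_continuous_image continuous_on_rabs)
      (auto simp: periodic_coeff_def elim: continuous_on_subset)
  then have "bdd_above ((\<lambda>t. \<bar>h t\<bar>) ` {0..\<omega>})"
    by (simp add: bounded_imp_bdd_above compact_imp_bounded)
  then have bdd: "bdd_above ((\<lambda>t. \<bar>h t\<bar>) ` {0<..\<omega>})"
    by (rule bdd_above_mono) auto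
  have pos: "\<bar>h t\<bar> \<le> sup_abs \<omega> h" if "0 < t" for t
  proof -
    define k where "k = nat (\<lceil>t / \<omega>\<rceil> - 1)"
    have "0 < t / \<omega>" using that \<open>0 < \<omega>\<close> by simp
    then have "real k = real_of_int \<lceil>t / \<omega>\<rceil> - 1"
      unfolding k_def by (simp add: of_nat_nat)
    then have "real k < t / \<omega>" "t / \<omega> \<le> real k + 1"
      by linarith+
    then have s: "t - real k * \<omega> \<in> {0<..\<omega>}"
      using \<open>0 < \<omega>\<close> by (simp add: field_simps)
    have "h t = h (t - real k * \<omega>)"
      using periodic_coeff_add_multiple[OF h \<open>0 < \<omega>\<close>, of "t - real k * \<omega>" k] s by simp
    then show ?thesis
      unfolding sup_abs_def using cSUP_upper[OF s bdd] by simp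
  qed
  show ?thesis
  proof (cases "t = 0")
    case True
    with pos[OF \<open>0 < \<omega>\<close>] h show ?thesis by (auto simp: periodic_coeff_def)
  qed (use pos \<open>0 \<le> t\<close> in auto)
qed

lemma H_class_lipschitz:
  assumes "H_class G g"
  shows "\<bar>g i x - g i y\<bar> \<le> G i * \<bar>x - y\<bar>"
proof (cases "x = y")
  case False
  then have "\<bar>g i (y + (x - y)) - g i y\<bar> / \<bar>x - y\<bar> \<le> G i"
    using assms unfolding H_class_def by (metis eq_iff_diff_eq_0)
  with False show ?thesis by (simp add: divide_le_eq)
qed simp

lemma H_class_continuous:
  assumes "H_class G g"
  shows "continuous_on S (g i)"
proof -
  have "(G i)-lipschitz_on UNIV (g i)" if "0 \<le> G i"
    using H_class_lipschitz[OF assms] that by (auto simp: lipschitz_on_def dist_real_def)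
  moreover have "0 \<le> G i"
    using H_class_lipschitz[OF assms, of i 1 0] by simp
  ultimately show ?thesis
    using lipschitz_on_continuous_on continuous_on_subset by blast
qed

section \<open>The periodic delay system\<close>

text \<open>What follows from periodicity and the Lipschitz conditions alone: solutions exist on the whole half-line, and the
set of solutions is closed under shifts by whole periods and under uniform limits.\<close>

locale periodic_delay_system =
  fixes \<omega> :: real
    and d :: "'n::finite \<Rightarrow> real \<Rightarrow> real"
    and a b :: "'n \<Rightarrow> 'n \<Rightarrow> real \<Rightarrow> real"
    and I :: "'n \<Rightarrow> real \<Rightarrow> real"
    and \<tau> :: "'n \<Rightarrow> 'n \<Rightarrow> real"
    and g f :: "'n \<Rightarrow> real \<Rightarrow> real"
    and G F :: "'n \<Rightarrow> real"
  assumes \<omega>: "0 < \<omega>"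
    and \<tau>: "\<And>i j. 0 \<le> \<tau> i j"
    and d: "\<And>i. periodic_coeff \<omega> (d i)"
    and a: "\<And>i j. periodic_coeff \<omega> (a i j)"
    and b: "\<And>i j. periodic_coeff \<omega> (b i j)"
    and I: "\<And>i. periodic_coeff \<omega> (I i)"
    and g: "H_class G g"
    and f: "H_class F f"
begin

abbreviation r :: real where "r \<equiv> max_delay \<tau>"
abbreviation A :: "'n \<Rightarrow> 'n \<Rightarrow> real" where "A i j \<equiv> sup_abs \<omega> (a i j)"
abbreviation B :: "'n \<Rightarrow> 'n \<Rightarrow> real" where "B i j \<equiv> sup_abs \<omega> (b i j)"

definition field :: "(real \<Rightarrow> real ^ 'n) \<Rightarrow> real \<Rightarrow> real ^ 'n" where
  "field u t = (\<chi> i. - d i t * u t $ i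
     + (\<Sum>j\<in>UNIV. a i j t * g j (u t $ j))
     + (\<Sum>j\<in>UNIV. b i j t * f j (u (t - \<tau> i j) $ j))
     + I i t)"

abbreviation sol :: "(real \<Rightarrow> real ^ 'n) \<Rightarrow> bool" where
  "sol \<equiv> solution d a b I \<tau> g f"

lemma sol_iff:
  "sol u \<longleftrightarrow> continuous_on {- r..} u \<and>
     (\<forall>t\<ge>0. \<forall>i. ((\<lambda>s. u s $ i) has_real_derivative field u t $ i) (at t within {0..}))"
  by (simp add: solution_def field_def)

lemma \<tau>_le_r: "\<tau> i j \<le> r"
  unfolding max_delay_def by (rule Max_ge) auto

lemma r_nonneg: "0 \<le> r"
  using \<tau>[of undefined undefined] \<tau>_le_r[of undefined undefined] by linarith

lemma ex_multiple_period_ge_delay: "\<exists>N::nat. r \<le> real N * \<omega>"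
proof -
  obtain N :: nat where "r / \<omega> \<le> real N" using real_arch_simple by blast
  then show ?thesis using \<omega> by (auto simp: field_simps)
qed

lemma periodic_add_multiple:
  assumes per: "\<And>t. - r \<le> t \<Longrightarrow> v (t + \<omega>) = v t" and "- r \<le> t"
  shows "v (t + real k * \<omega>) = v t"
proof (induction k)
  case (Suc k)
  have "- r \<le> t + real k * \<omega>" using \<open>- r \<le> t\<close> \<omega> by (simp add: add_increasing2)
  from per[OF this] Suc show ?case by (simp add: algebra_simps)
qed simp

lemma A_bound: "0 \<le> t \<Longrightarrow> \<bar>a i j t\<bar> \<le> A i j"
  and B_bound: "0 \<le> t \<Longrightarrow> \<bar>b i j t\<bar> \<le> B i j"
  by (simp_all add: abs_le_sup_abs a b \<omega>)

lemma A_nonneg: "0 \<le> A i j" and B_nonneg: "0 \<le> B i j"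
  using A_bound[of 0 i j] B_bound[of 0 i j] by auto

text \<open>Adding \<open>d\<^sub>i u\<^sub>i\<close> cancels the decay term of the field. It is kept apart because it
enters the stability estimate with its sign, whereas the interaction terms enter by absolute value.\<close>

lemma interaction_lipschitz:
  assumes "0 \<le> t"
  shows "\<bar>(field u t $ i + d i t * u t $ i) - (field w t $ i + d i t * w t $ i)\<bar>
    \<le> (\<Sum>j\<in>UNIV. A i j * (G j * \<bar>u t $ j - w t $ j\<bar>))
      + (\<Sum>j\<in>UNIV. B i j * (F j * \<bar>u (t - \<tau> i j) $ j - w (t - \<tau> i j) $ j\<bar>))"
proof -
  have "\<bar>(field u t $ i + d i t * u t $ i) - (field w t $ i + d i t * w t $ i)\<bar>
      = \<bar>(\<Sum>j\<in>UNIV. a i j t * (g j (u t $ j) - g j (w t $ j)))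
      + (\<Sum>j\<in>UNIV. b i j t * (f j (u (t - \<tau> i j) $ j) - f j (w (t - \<tau> i j) $ j)))\<bar>"
    by (simp add: field_def sum_subtractf algebra_simps)
  also have "\<dots> \<le>
      (\<Sum>j\<in>UNIV. \<bar>a i j t * (g j (u t $ j) - g j (w t $ j))\<bar>)
      + (\<Sum>j\<in>UNIV. \<bar>b i j t * (f j (u (t - \<tau> i j) $ j) - f j (w (t - \<tau> i j) $ j))\<bar>)"
    by (rule order_trans[OF abs_triangle_ineq add_mono[OF sum_abs sum_abs]])
  also have "\<dots> \<le> (\<Sum>j\<in>UNIV. A i j * (G j * \<bar>u t $ j - w t $ j\<bar>))
      + (\<Sum>j\<in>UNIV. B i j * (F j * \<bar>u (t - \<tau> i j) $ j - w (t - \<tau> i j) $ j\<bar>))"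
  proof (intro add_mono sum_mono)
    fix j
    show "\<bar>a i j t * (g j (u t $ j) - g j (w t $ j))\<bar> \<le> A i j * (G j * \<bar>u t $ j - w t $ j\<bar>)"
      unfolding abs_mult
      by (rule mult_mono[OF A_bound[OF assms] H_class_lipschitz[OF g] A_nonneg abs_ge_zero])
    show "\<bar>b i j t * (f j (u (t - \<tau> i j) $ j) - f j (w (t - \<tau> i j) $ j))\<bar>
        \<le> B i j * (F j * \<bar>u (t - \<tau> i j) $ j - w (t - \<tau> i j) $ j\<bar>)"
      unfolding abs_mult
      by (rule mult_mono[OF B_bound[OF assms] H_class_lipschitz[OF f] B_nonneg abs_ge_zero])
  qed
  finally show ?thesis .
qed

text \<open>A Lipschitz constant for the whole field; the constants of the components are added because the
Euclidean norm is at most the sum of the absolute values of the components.\<close>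

definition K :: real where
  "K = (\<Sum>i\<in>UNIV. sup_abs \<omega> (d i) + (\<Sum>j\<in>UNIV. A i j * G j) + (\<Sum>j\<in>UNIV. B i j * F j))"

lemma G_nonneg: "0 \<le> G i" and F_nonneg: "0 \<le> F i"
  using H_class_lipschitz[OF g, of i 1 0] H_class_lipschitz[OF f, of i 1 0] by auto

lemma K_nonneg: "0 \<le> K"
  unfolding K_def
  by (intro sum_nonneg add_nonneg_nonneg mult_nonneg_nonneg A_nonneg B_nonneg G_nonneg F_nonneg
      order_trans[OF abs_ge_zero abs_le_sup_abs[OF d \<omega> order_refl]])

lemma field_lipschitz:
  assumes "0 \<le> t" and m: "\<And>s. - r \<le> s \<Longrightarrow> s \<le> t \<Longrightarrow> norm (u s - w s) \<le> m"
  shows "norm (field u t - field w t) \<le> K * m"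
proof -
  have comp: "\<bar>u s $ j - w s $ j\<bar> \<le> m" if "- r \<le> s" "s \<le> t" for s j
    using component_le_norm_cart[of "u s - w s" j] m[OF that] by simp
  have "\<bar>field u t $ i - field w t $ i\<bar> \<le>
      (sup_abs \<omega> (d i) + (\<Sum>j\<in>UNIV. A i j * G j) + (\<Sum>j\<in>UNIV. B i j * F j)) * m" for i
  proof -
    have "\<bar>field u t $ i - field w t $ i\<bar> \<le>
        \<bar>(field u t $ i + d i t * u t $ i) - (field w t $ i + d i t * w t $ i)\<bar>
        + \<bar>d i t\<bar> * \<bar>u t $ i - w t $ i\<bar>"
      unfolding abs_mult[symmetric] by (simp add: algebra_simps)
    also have "\<dots> \<le> (\<Sum>j\<in>UNIV. A i j * (G j * m)) + (\<Sum>j\<in>UNIV. B i j * (F j * m))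
        + sup_abs \<omega> (d i) * m"
    proof (rule add_mono)
      show "\<bar>(field u t $ i + d i t * u t $ i) - (field w t $ i + d i t * w t $ i)\<bar>
          \<le> (\<Sum>j\<in>UNIV. A i j * (G j * m)) + (\<Sum>j\<in>UNIV. B i j * (F j * m))"
        by (rule order_trans[OF interaction_lipschitz[OF \<open>0 \<le> t\<close>]],
            intro add_mono sum_mono mult_left_mono comp A_nonneg B_nonneg G_nonneg F_nonneg)
          (use \<tau> \<tau>_le_r \<open>0 \<le> t\<close> r_nonneg in \<open>auto simp: algebra_simps add_increasing2 intro: add_increasing\<close>)
      show "\<bar>d i t\<bar> * \<bar>u t $ i - w t $ i\<bar> \<le> sup_abs \<omega> (d i) * m"
        using comp[of t i] r_nonneg \<open>0 \<le> t\<close> abs_le_sup_abs[OF d \<omega> \<open>0 \<le> t\<close>, of i]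
        by (intro mult_mono) auto
    qed
    finally show ?thesis by (simp add: sum_distrib_left sum_distrib_right algebra_simps)
  qed
  then have "norm (field u t - field w t) \<le> (\<Sum>i\<in>UNIV.
      (sup_abs \<omega> (d i) + (\<Sum>j\<in>UNIV. A i j * G j) + (\<Sum>j\<in>UNIV. B i j * F j)) * m)"
    by (intro order_trans[OF norm_le_l1_cart] sum_mono) simp
  then show ?thesis by (simp add: K_def sum_distrib_right)
qed

lemma field_continuous:
  assumes "continuous_on UNIV u"
  shows "continuous_on {0..} (field u)"
proof -
  have u: "continuous_on {0..} (\<lambda>t. u (t - c) $ j)" for c j
    by (intro continuous_intros continuous_on_compose2[OF assms]) auto
  have u0: "continuous_on {0..} (\<lambda>t. u t $ j)" for j
    using u[of 0] by simp
  have gu: "continuous_on {0..} (\<lambda>t. g j (u t $ j))" for j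
    by (rule continuous_on_compose2[OF H_class_continuous[OF g, of UNIV] u0]) simp
  have fu: "continuous_on {0..} (\<lambda>t. f j (u (t - c) $ j))" for c j
    by (rule continuous_on_compose2[OF H_class_continuous[OF f, of UNIV] u]) simp
  have coeff: "continuous_on {0..} h" if "periodic_coeff \<omega> h" for h
    using that by (simp add: periodic_coeff_def)
  show ?thesis
    unfolding field_def
    by (intro continuous_on_vec_lambda continuous_on_add continuous_on_mult continuous_on_minus
        continuous_on_sum u0 gu fu coeff a b d I)
qed

text \<open>The Lipschitz constant and the growth bound hold for all times at once because periodic coefficients
are bounded.\<close>

lemma ex_solution: "\<exists>u. sol u"
proof -
  have cont: "continuous_on {0..} (field (\<lambda>_. 0))"
    by (intro field_continuous continuous_intros)
  have field0: "field (\<lambda>_. 0) (t + real k * \<omega>) = field (\<lambda>_. 0) t" if "0 \<le> t" for t k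
    using that periodic_coeff_add_multiple[OF a \<omega>] periodic_coeff_add_multiple[OF b \<omega>]
      periodic_coeff_add_multiple[OF I \<omega>]
    by (simp add: field_def)
  have "periodic_coeff \<omega> (\<lambda>t. norm (field (\<lambda>_. 0) t))"
    unfolding periodic_coeff_def using field0[of _ 1] by (auto intro: continuous_on_norm[OF cont])
  from abs_le_sup_abs[OF this \<omega>] obtain C where C: "\<And>t. 0 \<le> t \<Longrightarrow> norm (field (\<lambda>_. 0) t) \<le> C"
    by auto
  obtain u where u: "continuous_on UNIV u"
    and der: "\<And>t. 0 \<le> t \<Longrightarrow> (u has_vector_derivative field u t) (at t within {0..})"
    using ex_causal_lipschitz_solution[of field K C] field_continuous field_lipschitz C K_nonneg
    by blast
  have "sol u"
    unfolding sol_iff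
    using continuous_on_subset[OF u] bounded_linear.has_vector_derivative[OF bounded_linear_vec_nth der]
    by (auto simp: has_real_derivative_iff_has_vector_derivative)
  then show ?thesis by blast
qed

lemma field_shift:
  assumes "0 \<le> t"
  shows "field (\<lambda>s. u (s + real k * \<omega>)) t = field u (t + real k * \<omega>)"
proof -
  have "u (t - \<tau> i j + real k * \<omega>) = u (t + real k * \<omega> - \<tau> i j)" for i j
    by (simp add: algebra_simps)
  then show ?thesis
    using assms by (simp add: field_def periodic_coeff_add_multiple[OF _ \<omega>] a b d I)
qed

text \<open>The derivative of the shift at \<open>t = 0\<close> is one-sided, while that of \<open>u\<close> at \<open>k \<omega>\<close> may be two-sided;
restricting to the shifted half-line handles both.\<close>

lemma sol_shift:
  assumes "sol u"
  shows "sol (\<lambda>t. u (t + real k * \<omega>))"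
  unfolding sol_iff
proof (intro conjI allI impI)
  show "continuous_on {- r..} (\<lambda>t. u (t + real k * \<omega>))"
  proof (rule continuous_on_compose2[of "{- r..}" u])
    show "continuous_on {- r..} u" using assms by (simp add: sol_iff)
    show "continuous_on {- r..} (\<lambda>t. t + real k * \<omega>)" by (intro continuous_intros)
    show "(\<lambda>t. t + real k * \<omega>) ` {- r..} \<subseteq> {- r..}" using \<omega> by (auto intro: add_increasing2)
  qed
next
  fix t :: real and i
  assume "0 \<le> t"
  then have "((\<lambda>s. u s $ i) has_real_derivative field u (real k * \<omega> + t) $ i)
      (at (real k * \<omega> + t) within {0..})"
    using assms \<omega> by (simp add: sol_iff)
  then have "((\<lambda>s. u s $ i) has_real_derivative field u (real k * \<omega> + t) $ i)
      (at (real k * \<omega> + t) within (+) (real k * \<omega>) ` {0..})"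
    by (rule DERIV_subset) (use \<omega> in auto)
  then show "((\<lambda>s. u (s + real k * \<omega>) $ i) has_real_derivative
      field (\<lambda>s. u (s + real k * \<omega>)) t $ i) (at t within {0..})"
    unfolding DERIV_at_within_shift field_shift[OF \<open>0 \<le> t\<close>] by (simp add: add.commute)
qed

text \<open>By \<open>field_lipschitz\<close>, uniform convergence of the solutions makes their derivatives converge
uniformly to the field of the limit.\<close>

lemma sol_uniform_limit:
  assumes w: "\<And>n. sol (w n)" and lim: "uniform_limit {- r..} w v sequentially"
  shows "sol v"
  unfolding sol_iff
proof (intro conjI allI impI)
  show "continuous_on {- r..} v"
    using w by (intro uniform_limit_theorem[OF _ lim]) (auto simp: sol_iff)
next
  fix t :: real and i
  assume "0 \<le> t"
  have pointwise: "(\<lambda>n. w n s $ i) \<longlonglongrightarrow> v s $ i" if "- r \<le> s" for s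
    using tendsto_uniform_limitI[OF lim] that by (intro tendsto_vec_nth) auto
  have conv: "\<forall>\<^sub>F n in sequentially. \<forall>s\<in>{0..}. \<forall>h.
      norm (field (w n) s $ i * h - field v s $ i * h) \<le> e * norm h" if "e > 0" for e
  proof -
    have "0 < e / (K + 1)" using that K_nonneg by simp
    from uniform_limitD[OF lim this]
    have "\<forall>\<^sub>F n in sequentially. \<forall>s\<in>{- r..}. dist (w n s) (v s) < e / (K + 1)" .
    then show ?thesis
    proof eventually_elim
      case (elim n)
      have "norm (field (w n) s $ i * h - field v s $ i * h) \<le> e * norm h" if "0 \<le> s" for s h
      proof -
        have "norm (field (w n) s $ i - field v s $ i) \<le> norm (field (w n) s - field v s)"
          using component_le_norm_cart[of "field (w n) s - field v s" i] by simp
        also have "\<dots> \<le> K * (e / (K + 1))"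
          using elim by (intro field_lipschitz[OF that]) (auto simp: dist_norm less_imp_le)
        also have "\<dots> \<le> e" using \<open>e > 0\<close> K_nonneg by (simp add: field_simps)
        finally show ?thesis
          by (simp add: left_diff_distrib[symmetric] abs_mult mult_right_mono)
      qed
      then show ?case by auto
    qed
  qed
  have "\<exists>x. \<forall>s\<in>{0..}. (\<lambda>n. w n s $ i) \<longlonglongrightarrow> x s \<and>
      (x has_derivative (*) (field v s $ i)) (at s within {0..})"
    using w pointwise[of 0] r_nonneg conv
    by (intro has_derivative_sequence[where f' = "\<lambda>n s. (*) (field (w n) s $ i)" and ?x0.0 = 0])
      (auto simp: sol_iff has_field_derivative_def)
  then obtain x where x: "\<And>s. 0 \<le> s \<Longrightarrow> (\<lambda>n. w n s $ i) \<longlonglongrightarrow> x s"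
    and dx: "\<And>s. 0 \<le> s \<Longrightarrow> (x has_real_derivative field v s $ i) (at s within {0..})"
    by (auto simp: has_field_derivative_def)
  have "x s = v s $ i" if "0 \<le> s" for s
    using LIMSEQ_unique[OF x pointwise] that r_nonneg by auto
  then show "((\<lambda>s. v s $ i) has_real_derivative field v t $ i) (at t within {0..})"
    by (intro has_field_derivative_transform_within[OF dx zero_less_one])
      (use \<open>0 \<le> t\<close> in auto)
qed

end

section \<open>The stability condition and the Lyapunov functional\<close>

lemma stability_lhs_special_eq:
  assumes "1 \<le> p" and conj: "p \<noteq> 1 \<Longrightarrow> 1 / p + 1 / q = 1"
    and "\<And>i j. 0 \<le> A i j" "\<And>i j. 0 \<le> B i j"
  shows "stability_lhs_special p q \<delta> A B \<tau> G F \<epsilon> \<xi> i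
    = stability_lhs p q \<delta> A B \<tau> G F \<epsilon> \<xi> (\<lambda>_ _. 1 / p) (\<lambda>_ _. 1 / p) i"
proof -
  have "(1 - 1 / p) * q = 1" if "p \<noteq> 1"
  proof -
    have "1 - 1 / p = 1 / q" "1 - 1 / p \<noteq> 0" using conj[OF that] that \<open>1 \<le> p\<close> by auto
    then show ?thesis by auto
  qed
  then show ?thesis
    using assms by (simp add: stability_lhs_def stability_lhs_special_def powr_one cong: if_cong)
qed

text \<open>\<open>Z i\<close> stands for the current value of \<open>z\<^sub>i powr p\<close> and \<open>Y i j\<close> for the value of \<open>z\<^sub>j powr p\<close> delayed
by \<open>\<tau>\<^sub>i\<^sub>j\<close>. Up to a common factor \<open>p\<close>, the first sum bounds the rate of the weighted sum of the powers, and the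
second is the rate of the integral terms.
The delayed values cancel, and exchanging the order of summation collects, as coefficient of
\<open>Z i\<close>, the column sums of \<open>P\<close> and \<open>R\<close> that occur in the stability inequality.\<close>

lemma sum_lyapunov_rate:
  fixes Z :: "'n::finite \<Rightarrow> real" and Y :: "'n \<Rightarrow> 'n \<Rightarrow> real"
  shows "(\<Sum>i\<in>UNIV. \<xi> i * (\<kappa> i * Z i
        + (\<Sum>j\<in>UNIV. G j * (P i j * Z j + Q i j * Z i))
        + (\<Sum>j\<in>UNIV. F j * E i j * (R i j * Y i j + S i j * Z i))))
      + (\<Sum>i\<in>UNIV. \<Sum>j\<in>UNIV. \<xi> i * F j * E i j * R i j * (Z j - Y i j))
    = (\<Sum>i\<in>UNIV. Z i * (\<kappa> i * \<xi> i
        + G i * (\<Sum>j\<in>UNIV. \<xi> j * P j i) + \<xi> i * (\<Sum>j\<in>UNIV. G j * Q i j)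
        + F i * (\<Sum>j\<in>UNIV. \<xi> j * R j i * E j i)
        + \<xi> i * (\<Sum>j\<in>UNIV. F j * S i j * E i j)))"
proof -
  have swap: "(\<Sum>i\<in>UNIV. \<Sum>j\<in>UNIV. \<xi> i * (G j * (P i j * Z j)))
      = (\<Sum>i\<in>UNIV. \<Sum>j\<in>UNIV. Z i * (G i * (\<xi> j * P j i)))"
    "(\<Sum>i\<in>UNIV. \<Sum>j\<in>UNIV. \<xi> i * (F j * (E i j * (R i j * Z j))))
      = (\<Sum>i\<in>UNIV. \<Sum>j\<in>UNIV. Z i * (F i * (\<xi> j * (R j i * E j i))))"
    by (subst sum.swap, simp add: mult_ac)+
  have "(\<Sum>i\<in>UNIV. \<xi> i * (\<kappa> i * Z i
        + (\<Sum>j\<in>UNIV. G j * (P i j * Z j + Q i j * Z i))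
        + (\<Sum>j\<in>UNIV. F j * E i j * (R i j * Y i j + S i j * Z i))))
      + (\<Sum>i\<in>UNIV. \<Sum>j\<in>UNIV. \<xi> i * F j * E i j * R i j * (Z j - Y i j))
    = (\<Sum>i\<in>UNIV. Z i * (\<kappa> i * \<xi> i))
      + (\<Sum>i\<in>UNIV. \<Sum>j\<in>UNIV. \<xi> i * (G j * (P i j * Z j)))
      + (\<Sum>i\<in>UNIV. \<Sum>j\<in>UNIV. Z i * (\<xi> i * (G j * Q i j)))
      + (\<Sum>i\<in>UNIV. \<Sum>j\<in>UNIV. \<xi> i * (F j * (E i j * (R i j * Z j))))
      + (\<Sum>i\<in>UNIV. \<Sum>j\<in>UNIV. Z i * (\<xi> i * (F j * (S i j * E i j))))"
    by (simp add: sum_distrib_left sum.distrib[symmetric] algebra_simps)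
  also have "\<dots> = (\<Sum>i\<in>UNIV. Z i * (\<kappa> i * \<xi> i
        + G i * (\<Sum>j\<in>UNIV. \<xi> j * P j i) + \<xi> i * (\<Sum>j\<in>UNIV. G j * Q i j)
        + F i * (\<Sum>j\<in>UNIV. \<xi> j * R j i * E j i)
        + \<xi> i * (\<Sum>j\<in>UNIV. F j * S i j * E i j)))"
    unfolding swap by (simp add: sum_distrib_left sum.distrib[symmetric] algebra_simps)
  finally show ?thesis .
qed

locale stable_delay_system = periodic_delay_system \<omega> d a b I \<tau> g f G F
  for \<omega> :: real
    and d :: "'n::finite \<Rightarrow> real \<Rightarrow> real"
    and a b :: "'n \<Rightarrow> 'n \<Rightarrow> real \<Rightarrow> real"
    and I :: "'n \<Rightarrow> real \<Rightarrow> real"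
    and \<tau> :: "'n \<Rightarrow> 'n \<Rightarrow> real"
    and g f :: "'n \<Rightarrow> real \<Rightarrow> real"
    and G F :: "'n \<Rightarrow> real" +
  fixes p q \<epsilon> :: real and \<delta> \<xi> :: "'n \<Rightarrow> real" and \<alpha> \<beta> :: "'n \<Rightarrow> 'n \<Rightarrow> real"
  assumes p: "1 \<le> p" and conj: "p \<noteq> 1 \<Longrightarrow> 1 / p + 1 / q = 1"
    and \<epsilon>: "0 < \<epsilon>" and \<xi>: "\<And>i. 0 < \<xi> i"
    and decay: "\<And>i t. 0 \<le> t \<Longrightarrow> \<delta> i \<le> d i t"
    and exponents: "p = 1 \<Longrightarrow> \<alpha> i j = 1" "p = 1 \<Longrightarrow> \<beta> i j = 1"
    and stability: "\<And>i. stability_lhs p q \<delta> A B \<tau> G F \<epsilon> \<xi> \<alpha> \<beta> i \<le> 0"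
begin

text \<open>The stability inequality has no exponent for the diagonal term \<open>\<xi>\<^sub>i A\<^sub>i\<^sub>i\<close>. Choosing \<open>1 / p\<close> there
splits \<open>A\<^sub>i\<^sub>i\<close> into the parts \<open>A\<^sub>i\<^sub>i / p\<close> and \<open>A\<^sub>i\<^sub>i / q\<close>, so the diagonal can be treated like
every other entry.\<close>

definition \<alpha>' :: "'n \<Rightarrow> 'n \<Rightarrow> real" where "\<alpha>' i j = (if i = j then 1 / p else \<alpha> i j)"

text \<open>The four weights that Young's inequality produces: \<open>P\<close> and \<open>R\<close> multiply the power of the influencing
component, \<open>Q\<close> and \<open>S\<close> that of the influenced one. The factor \<open>c x\<close> is \<open>x powr (p - 1)\<close>,
corrected to \<open>1\<close> for \<open>p = 1\<close>.\<close>

definition P :: "'n \<Rightarrow> 'n \<Rightarrow> real" where "P i j = 1 / p * A i j powr (\<alpha>' i j * p)"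
definition Q :: "'n \<Rightarrow> 'n \<Rightarrow> real" where
  "Q i j = (if p = 1 then 0 else 1 / q * A i j powr ((1 - \<alpha>' i j) * q))"
definition R :: "'n \<Rightarrow> 'n \<Rightarrow> real" where "R i j = 1 / p * B i j powr (\<beta> i j * p)"
definition S :: "'n \<Rightarrow> 'n \<Rightarrow> real" where
  "S i j = (if p = 1 then 0 else 1 / q * B i j powr ((1 - \<beta> i j) * q))"
definition E :: "'n \<Rightarrow> 'n \<Rightarrow> real" where "E i j = exp (\<epsilon> * \<tau> i j)"
definition c :: "real \<Rightarrow> real" where "c x = (if p = 1 then 1 else x powr (p - 1))"

lemma c_nonneg: "0 \<le> c x"
  by (simp add: c_def)

lemma c_mult_self: "0 \<le> x \<Longrightarrow> c x * x = x powr p"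
  by (cases "x = 0") (auto simp: c_def powr_diff powr_one)

lemma Young_A: "0 \<le> x \<Longrightarrow> 0 \<le> y \<Longrightarrow> c x * (A i j * y) \<le> P i j * y powr p + Q i j * x powr p"
  unfolding c_def P_def Q_def \<alpha>'_def
  by (intro Young_powr p conj A_nonneg) (auto simp: exponents)

lemma Young_B: "0 \<le> x \<Longrightarrow> 0 \<le> y \<Longrightarrow> c x * (B i j * y) \<le> R i j * y powr p + S i j * x powr p"
  unfolding c_def R_def S_def by (intro Young_powr p conj B_nonneg) (auto simp: exponents)

lemma R_nonneg: "0 \<le> R i j"
  using p by (simp add: R_def)

lemma PQ_diag: "P i i + Q i i = A i i"
proof (cases "p = 1")
  case True
  then show ?thesis unfolding P_def Q_def \<alpha>'_def by (simp add: powr_one A_nonneg)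
next
  case False
  have "1 - 1 / p = 1 / q" "1 - 1 / p \<noteq> 0" using conj[OF False] False p by auto
  then have "(1 - 1 / p) * q = 1" by auto
  moreover have "A i i / p + A i i / q = (1 / p + 1 / q) * A i i" by (simp add: algebra_simps)
  ultimately show ?thesis
    using False p conj[OF False] by (simp add: P_def Q_def \<alpha>'_def powr_one A_nonneg)
qed

text \<open>The stability inequality in terms of the weights: the two diagonal shares \<open>P i i\<close> and \<open>Q i i\<close>
recombine to \<open>A i i\<close>.\<close>

lemma column_condition:
  "(\<epsilon> - \<delta> i) * \<xi> i
    + G i * (\<Sum>j\<in>UNIV. \<xi> j * P j i) + \<xi> i * (\<Sum>j\<in>UNIV. G j * Q i j)
    + F i * (\<Sum>j\<in>UNIV. \<xi> j * R j i * E j i) + \<xi> i * (\<Sum>j\<in>UNIV. F j * S i j * E i j) \<le> 0"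
proof -
  have 1: "(\<Sum>j\<in>UNIV. \<xi> j * P j i)
      = \<xi> i * P i i + 1 / p * (\<Sum>j\<in>UNIV - {i}. \<xi> j * A j i powr (\<alpha> j i * p))"
    by (subst sum.remove[of UNIV i])
      (auto simp: P_def \<alpha>'_def sum_distrib_left intro!: sum.cong)
  have 2: "(\<Sum>j\<in>UNIV. G j * Q i j) = G i * Q i i + (if p = 1 then 0
      else 1 / q * (\<Sum>j\<in>UNIV - {i}. G j * A i j powr ((1 - \<alpha> i j) * q)))"
    by (subst sum.remove[of UNIV i])
      (auto simp: Q_def \<alpha>'_def sum_distrib_left intro!: sum.cong)
  have 3: "(\<Sum>j\<in>UNIV. \<xi> j * R j i * E j i)
      = 1 / p * (\<Sum>j\<in>UNIV. \<xi> j * B j i powr (\<beta> j i * p) * exp (\<epsilon> * \<tau> j i))"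
    by (auto simp: R_def E_def sum_distrib_left intro!: sum.cong)
  have 4: "(\<Sum>j\<in>UNIV. F j * S i j * E i j) = (if p = 1 then 0
      else 1 / q * (\<Sum>j\<in>UNIV. F j * B i j powr ((1 - \<beta> i j) * q) * exp (\<epsilon> * \<tau> i j)))"
    by (auto simp: S_def E_def sum_distrib_left intro!: sum.cong)
  have "G i * (\<xi> i * P i i) + \<xi> i * (G i * Q i i) = G i * (\<xi> i * A i i)"
    unfolding PQ_diag[symmetric] by (simp add: algebra_simps)
  then show ?thesis
    using stability[of i] unfolding 1 2 3 4 stability_lhs_def
    by (simp add: algebra_simps split: if_splits)
qed

text \<open>The factor \<open>exp (\<epsilon> t)\<close> contributes the rate \<open>\<epsilon>\<close>, and the sign of the decay term survives the
absolute value. In a delayed term only \<open>exp (\<epsilon> (t - \<tau>\<^sub>i\<^sub>j))\<close> belongs to \<open>z\<^sub>j (t - \<tau>\<^sub>i\<^sub>j)\<close>; the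
rest is \<open>E i j\<close>.\<close>

lemma scaled_difference_right_derivative:
  assumes u: "sol u" and w: "sol w" and "0 \<le> t"
  defines "z \<equiv> \<lambda>i s. exp (\<epsilon> * s) * \<bar>u s $ i - w s $ i\<bar>"
  shows "\<exists>D. (z i has_real_derivative D) (at t within {t..}) \<and>
    D \<le> (\<epsilon> - \<delta> i) * z i t + (\<Sum>j\<in>UNIV. A i j * (G j * z j t))
      + (\<Sum>j\<in>UNIV. B i j * (F j * (E i j * z j (t - \<tau> i j))))"
proof -
  define x where "x s = u s $ i - w s $ i" for s
  define x' where "x' = field u t $ i - field w t $ i"
  define h where "h = x' + d i t * x t"
  have "(x has_real_derivative x') (at t within {0..})"
    unfolding x_def x'_def using u w \<open>0 \<le> t\<close> by (auto simp: sol_iff intro: DERIV_diff)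
  then have "(x has_real_derivative x') (at t within {t..})"
    by (rule DERIV_subset) (use \<open>0 \<le> t\<close> in auto)
  from abs_has_right_derivative[OF this] obtain D
    where D: "((\<lambda>s. \<bar>x s\<bar>) has_real_derivative D) (at t within {t..})"
      and D_eq: "D = (if x t = 0 then \<bar>x'\<bar> else sgn (x t) * x')" by blast
  have "D \<le> - d i t * \<bar>x t\<bar> + \<bar>h\<bar>"
    unfolding D_eq h_def
    by (cases "x t" "0 :: real" rule: linorder_cases) (auto simp: abs_if algebra_simps)
  moreover have "\<delta> i * \<bar>x t\<bar> \<le> d i t * \<bar>x t\<bar>"
    using decay[OF \<open>0 \<le> t\<close>] by (intro mult_right_mono) auto
  ultimately have "\<epsilon> * \<bar>x t\<bar> + D \<le> (\<epsilon> - \<delta> i) * \<bar>x t\<bar> + \<bar>h\<bar>"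
    by (simp add: algebra_simps)
  also have "\<bar>h\<bar> \<le> (\<Sum>j\<in>UNIV. A i j * (G j * \<bar>u t $ j - w t $ j\<bar>))
      + (\<Sum>j\<in>UNIV. B i j * (F j * \<bar>u (t - \<tau> i j) $ j - w (t - \<tau> i j) $ j\<bar>))"
    using interaction_lipschitz[OF \<open>0 \<le> t\<close>, of u i w]
    by (simp add: h_def x'_def x_def algebra_simps)
  finally have "exp (\<epsilon> * t) * (\<epsilon> * \<bar>x t\<bar> + D) \<le> exp (\<epsilon> * t) * ((\<epsilon> - \<delta> i) * \<bar>x t\<bar>
      + ((\<Sum>j\<in>UNIV. A i j * (G j * \<bar>u t $ j - w t $ j\<bar>))
      + (\<Sum>j\<in>UNIV. B i j * (F j * \<bar>u (t - \<tau> i j) $ j - w (t - \<tau> i j) $ j\<bar>))))"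
    by (simp add: mult_left_mono)
  also have "\<dots> = (\<epsilon> - \<delta> i) * z i t + (\<Sum>j\<in>UNIV. A i j * (G j * z j t))
      + (\<Sum>j\<in>UNIV. B i j * (F j * (E i j * z j (t - \<tau> i j))))"
  proof -
    have "E i j * z j (t - \<tau> i j) = exp (\<epsilon> * t) * \<bar>u (t - \<tau> i j) $ j - w (t - \<tau> i j) $ j\<bar>" for j
    proof -
      have "exp (\<epsilon> * t) = E i j * exp (\<epsilon> * (t - \<tau> i j))"
        by (simp add: E_def mult_exp_exp algebra_simps)
      then show ?thesis by (simp add: z_def)
    qed
    note Ez = this
    show ?thesis
      unfolding Ez by (simp add: z_def x_def sum_distrib_left algebra_simps)
  qed
  finally have "exp (\<epsilon> * t) * (\<epsilon> * \<bar>x t\<bar> + D) \<le> \<dots>" .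
  moreover have "(z i has_real_derivative exp (\<epsilon> * t) * (\<epsilon> * \<bar>x t\<bar> + D)) (at t within {t..})"
    unfolding z_def using D unfolding x_def
    by (auto intro!: derivative_eq_intros simp: algebra_simps)
  ultimately show ?thesis by blast
qed

text \<open>By the chain rule the bound on the rate of \<open>z\<^sub>i\<close> is multiplied by \<open>p * c (z\<^sub>i)\<close>. Young's inequality
then removes all products of different components.\<close>

lemma powr_difference_right_derivative:
  assumes u: "sol u" and w: "sol w" and "0 \<le> t"
  defines "Z \<equiv> \<lambda>i s. (exp (\<epsilon> * s) * \<bar>u s $ i - w s $ i\<bar>) powr p"
  shows "\<exists>D. (Z i has_real_derivative D) (at t within {t..}) \<and>
    D \<le> p * ((\<epsilon> - \<delta> i) * Z i t + (\<Sum>j\<in>UNIV. G j * (P i j * Z j t + Q i j * Z i t))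
      + (\<Sum>j\<in>UNIV. F j * E i j * (R i j * Z j (t - \<tau> i j) + S i j * Z i t)))"
proof -
  define z where "z i s = exp (\<epsilon> * s) * \<bar>u s $ i - w s $ i\<bar>" for i s
  have Z: "Z i s = z i s powr p" for i s by (simp add: Z_def z_def)
  have z_nonneg: "0 \<le> z i s" for i s by (simp add: z_def)
  obtain D where D: "(z i has_real_derivative D) (at t within {t..})"
    and D_le: "D \<le> (\<epsilon> - \<delta> i) * z i t + (\<Sum>j\<in>UNIV. A i j * (G j * z j t))
      + (\<Sum>j\<in>UNIV. B i j * (F j * (E i j * z j (t - \<tau> i j))))"
    using scaled_difference_right_derivative[OF u w \<open>0 \<le> t\<close>, of i] unfolding z_def by blast
  have "(Z i has_real_derivative p * c (z i t) * D) (at t within {t..})"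
    unfolding Z c_def by (rule powr_has_right_derivative[OF p D z_nonneg])
  moreover have "p * c (z i t) * D \<le>
      p * ((\<epsilon> - \<delta> i) * Z i t + (\<Sum>j\<in>UNIV. G j * (P i j * Z j t + Q i j * Z i t))
      + (\<Sum>j\<in>UNIV. F j * E i j * (R i j * Z j (t - \<tau> i j) + S i j * Z i t)))"
  proof -
    have "c (z i t) * D \<le> c (z i t) * ((\<epsilon> - \<delta> i) * z i t + (\<Sum>j\<in>UNIV. A i j * (G j * z j t))
      + (\<Sum>j\<in>UNIV. B i j * (F j * (E i j * z j (t - \<tau> i j)))))"
      by (rule mult_left_mono[OF D_le c_nonneg])
    also have "\<dots> = (\<epsilon> - \<delta> i) * (c (z i t) * z i t)
      + (\<Sum>j\<in>UNIV. G j * (c (z i t) * (A i j * z j t)))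
      + (\<Sum>j\<in>UNIV. F j * E i j * (c (z i t) * (B i j * z j (t - \<tau> i j))))"
      by (simp add: sum_distrib_left algebra_simps)
    also have "\<dots> \<le> (\<epsilon> - \<delta> i) * Z i t + (\<Sum>j\<in>UNIV. G j * (P i j * Z j t + Q i j * Z i t))
      + (\<Sum>j\<in>UNIV. F j * E i j * (R i j * Z j (t - \<tau> i j) + S i j * Z i t))"
      unfolding Z c_mult_self[OF z_nonneg]
      by (intro add_mono sum_mono mult_left_mono Young_A Young_B z_nonneg G_nonneg order_refl
          mult_nonneg_nonneg F_nonneg) (simp add: E_def)
    finally show ?thesis using p by (simp add: mult.assoc)
  qed
  ultimately show ?thesis by blast
qed

text \<open>The functional \<open>V\<close> is nonincreasing, and \<open>\<xi>\<^sub>i z\<^sub>i(t)\<^sup>p \<le> V t \<le> V 0\<close>. The integral of \<open>Z j\<close> over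
\<open>[t - \<tau>\<^sub>i\<^sub>j, t]\<close> is written as a difference of values of the primitive \<open>M j\<close> based at \<open>- r\<close>,
which is where the histories begin.\<close>

lemma solutions_converge:
  assumes u: "sol u" and w: "sol w"
  shows "\<exists>C. \<forall>t\<ge>0. \<forall>i. \<bar>u t $ i - w t $ i\<bar> \<le> C * exp (- (\<epsilon> * t))"
proof -
  define Z where "Z i s = (exp (\<epsilon> * s) * \<bar>u s $ i - w s $ i\<bar>) powr p" for i s
  have Z_nonneg: "0 \<le> Z i s" for i s by (simp add: Z_def)
  have Z_cont: "continuous_on {- r..} (Z i)" for i
    unfolding Z_def using u w p
    by (intro continuous_on_powr' continuous_intros) (auto simp: sol_iff)
  have Z_int: "Z i integrable_on {- r..s}" for i s
    by (intro integrable_continuous_real continuous_on_subset[OF Z_cont]) auto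
  define M where "M i s = integral {- r..s} (Z i)" for i s
  have M_deriv: "(M i has_real_derivative Z i s) (at s within {s..})" if "- r \<le> s" for i s
  proof -
    have "(M i has_real_derivative Z i s) (at s within {- r..s+1})"
      unfolding M_def using that
      by (intro integral_has_real_derivative continuous_on_subset[OF Z_cont]) auto
    then have "(M i has_real_derivative Z i s) (at s within {s..s+1})"
      by (rule DERIV_subset) (use that in auto)
    moreover have "at s within {s..s+1} = at s within {s..}"
      by (rule at_within_nhd[of s "{s-1<..<s+1}"]) auto
    ultimately show ?thesis by simp
  qed
  have M_shift: "((\<lambda>s. M i (s - e)) has_real_derivative Z i (t - e)) (at t within {t..})"
    if "- r \<le> t - e" for i t e
  proof -
    have "(+) (- e) ` {t..} = {t - e..}"
      using image_add_atLeast[of "- e" t] by (simp add: algebra_simps)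
    then show ?thesis
      using DERIV_at_within_shift[of "M i" "Z i (t - e)" "- e" t "{t..}"] M_deriv[OF that]
      by (simp add: algebra_simps)
  qed
  have M_cont: "continuous_on {- r..T} (M i)" for i T
    unfolding M_def by (intro indefinite_integral_continuous_1 Z_int)
  define V where "V s = (\<Sum>i\<in>UNIV. \<xi> i * Z i s)
      + p * (\<Sum>i\<in>UNIV. \<Sum>j\<in>UNIV. \<xi> i * F j * E i j * R i j * (M j s - M j (s - \<tau> i j)))" for s
  have delay: "- r \<le> t - \<tau> i j" if "0 \<le> t" for t i j
    using that \<tau>_le_r[of i j] by simp
  have V_le: "V t \<le> V 0" if "0 \<le> t" for t
  proof (rule right_derivative_nonpos_imp_le[OF that])
    have "continuous_on {0..t} (\<lambda>s. M j (s - \<tau> i j))" for i j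
      by (rule continuous_on_compose2[OF M_cont[of t]])
        (use \<tau>[of i j] \<tau>_le_r[of i j] in \<open>auto intro!: continuous_intros\<close>)
    moreover have "continuous_on {0..t} (M j)" "continuous_on {0..t} (Z j)" for j
      using r_nonneg by (auto intro: continuous_on_subset[OF M_cont[of t]] continuous_on_subset[OF Z_cont])
    ultimately show "continuous_on {0..t} V"
      unfolding V_def by (intro continuous_intros)
  next
    fix s :: real
    assume "0 \<le> s"
    define X where "X i = (\<epsilon> - \<delta> i) * Z i s
      + (\<Sum>j\<in>UNIV. G j * (P i j * Z j s + Q i j * Z i s))
      + (\<Sum>j\<in>UNIV. F j * E i j * (R i j * Z j (s - \<tau> i j) + S i j * Z i s))" for i
    have "\<exists>D. (Z i has_real_derivative D) (at s within {s..}) \<and> D \<le> p * X i" for i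
      using powr_difference_right_derivative[OF u w \<open>0 \<le> s\<close>, of i]
      unfolding X_def Z_def .
    then obtain D where D: "\<And>i. (Z i has_real_derivative D i) (at s within {s..})"
      and D_le: "\<And>i. D i \<le> p * X i"
      by metis
    define D' where "D' = (\<Sum>i\<in>UNIV. \<xi> i * D i)
      + p * (\<Sum>i\<in>UNIV. \<Sum>j\<in>UNIV. \<xi> i * F j * E i j * R i j * (Z j s - Z j (s - \<tau> i j)))"
    have "(V has_real_derivative D') (at s within {s..})"
      unfolding V_def D'_def using \<open>0 \<le> s\<close> r_nonneg
      by (intro DERIV_add DERIV_sum DERIV_cmult DERIV_diff D M_deriv M_shift delay) auto
    moreover have "D' \<le> 0"
    proof -
      have "D' \<le> (\<Sum>i\<in>UNIV. \<xi> i * (p * X i))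
        + p * (\<Sum>i\<in>UNIV. \<Sum>j\<in>UNIV. \<xi> i * F j * E i j * R i j * (Z j s - Z j (s - \<tau> i j)))"
        unfolding D'_def using \<xi>
        by (intro add_mono sum_mono mult_left_mono D_le order_refl) (auto intro: less_imp_le)
      also have "(\<Sum>i\<in>UNIV. \<xi> i * (p * X i)) = p * (\<Sum>i\<in>UNIV. \<xi> i * X i)"
        by (simp add: sum_distrib_left mult.left_commute)
      also have "p * (\<Sum>i\<in>UNIV. \<xi> i * X i) + p * (\<Sum>i\<in>UNIV. \<Sum>j\<in>UNIV. \<xi> i * F j * E i j * R i j * (Z j s - Z j (s - \<tau> i j)))
        = p * ((\<Sum>i\<in>UNIV. \<xi> i * X i) + (\<Sum>i\<in>UNIV. \<Sum>j\<in>UNIV. \<xi> i * F j * E i j * R i j * (Z j s - Z j (s - \<tau> i j))))"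
        by (simp only: distrib_left)
      also have "\<dots> = p * (\<Sum>i\<in>UNIV. Z i s * ((\<epsilon> - \<delta> i) * \<xi> i
          + G i * (\<Sum>j\<in>UNIV. \<xi> j * P j i) + \<xi> i * (\<Sum>j\<in>UNIV. G j * Q i j)
          + F i * (\<Sum>j\<in>UNIV. \<xi> j * R j i * E j i) + \<xi> i * (\<Sum>j\<in>UNIV. F j * S i j * E i j)))"
        by (simp only: X_def sum_lyapunov_rate)
      also have "\<dots> \<le> 0"
        using p by (intro mult_nonneg_nonpos sum_nonpos Z_nonneg column_condition) auto
      finally show ?thesis .
    qed
    ultimately show "\<exists>D\<le>0. (V has_real_derivative D) (at s within {s..})" by blast
  qed
  have Z_le: "\<xi> i * Z i t \<le> V t" if "0 \<le> t" for i t
  proof -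
    have "M j (t - \<tau> i j) \<le> M j t" for i j
      unfolding M_def using \<tau>[of i j] by (intro integral_subset_le Z_int) (auto simp: Z_nonneg)
    then have "0 \<le> (\<Sum>i\<in>UNIV. \<Sum>j\<in>UNIV. \<xi> i * F j * E i j * R i j * (M j t - M j (t - \<tau> i j)))"
      using less_imp_le[OF \<xi>] F_nonneg R_nonneg
      by (intro sum_nonneg mult_nonneg_nonneg) (auto simp: E_def)
    moreover have "\<xi> i * Z i t \<le> (\<Sum>i\<in>UNIV. \<xi> i * Z i t)"
      using less_imp_le[OF \<xi>] Z_nonneg by (intro member_le_sum mult_nonneg_nonneg) auto
    ultimately show ?thesis unfolding V_def using p by (simp add: add_increasing2)
  qed
  define C where "C = (\<Sum>i\<in>UNIV. (V 0 / \<xi> i) powr (1 / p))"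
  have "\<bar>u t $ i - w t $ i\<bar> \<le> C * exp (- (\<epsilon> * t))" if "0 \<le> t" for t i
  proof -
    define x where "x = exp (\<epsilon> * t) * \<bar>u t $ i - w t $ i\<bar>"
    have "0 \<le> x" by (simp add: x_def)
    have "x powr p \<le> V 0 / \<xi> i"
      using order_trans[OF Z_le[OF that, of i] V_le[OF that]] \<xi>[of i]
      by (simp add: x_def Z_def pos_le_divide_eq mult.commute)
    then have "(x powr p) powr (1 / p) \<le> (V 0 / \<xi> i) powr (1 / p)"
      using p by (intro powr_mono2) auto
    then have "x \<le> (V 0 / \<xi> i) powr (1 / p)"
      using p \<open>0 \<le> x\<close> by (simp add: powr_powr powr_one)
    also have "\<dots> \<le> C"
      unfolding C_def by (rule member_le_sum) auto
    finally show ?thesis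
      by (simp add: x_def exp_minus field_simps)
  qed
  then show ?thesis by blast
qed

section \<open>The periodic solution\<close>

text \<open>The limit of the shifts of an arbitrary solution by whole periods. The first \<open>N\<close> shifts are skipped, with
\<open>r \<le> N \<omega>\<close>, because the decay estimate holds at nonnegative times only and is needed on all of
\<open>[- r, \<infinity>)\<close>.\<close>

lemma ex_periodic_solution: "\<exists>v. sol v \<and> (\<forall>t\<ge>- r. v (t + \<omega>) = v t)"
proof -
  obtain u where u: "sol u" using ex_solution by blast
  define w where "w k t = u (t + real k * \<omega>)" for k t
  have w: "sol (w k)" for k unfolding w_def by (rule sol_shift[OF u])
  obtain C where C: "\<And>t i. 0 \<le> t \<Longrightarrow> \<bar>w 1 t $ i - u t $ i\<bar> \<le> C * exp (- (\<epsilon> * t))"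
    using solutions_converge[OF w u] by blast
  obtain N :: nat where N: "r \<le> real N * \<omega>" using ex_multiple_period_ge_delay by blast
  have "0 \<le> C" using order_trans[OF abs_ge_zero C[of 0]] by simp
  define q where "q = exp (- (\<epsilon> * \<omega>))"
  have step: "norm (w (Suc k + N) t - w (k + N) t) \<le> real CARD('n) * C * q ^ k"
    if "t \<in> {- r..}" for k t
  proof -
    define s where "s = t + real N * \<omega> + real k * \<omega>"
    have s: "0 \<le> s" "real k * \<omega> \<le> s" using that N \<omega> by (auto simp: s_def)
    have "norm (w (Suc k + N) t - w (k + N) t) = norm (w 1 s - u s)"
      by (simp add: w_def s_def algebra_simps)
    also have "\<dots> \<le> (\<Sum>i\<in>UNIV. \<bar>(w 1 s - u s) $ i\<bar>)" by (rule norm_le_l1_cart)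
    also have "\<dots> \<le> real CARD('n) * (C * exp (- (\<epsilon> * s)))"
      using C[OF s(1)] by (intro sum_bounded_above) auto
    also have "\<dots> \<le> real CARD('n) * (C * exp (- (\<epsilon> * (real k * \<omega>))))"
      using s \<epsilon> \<open>0 \<le> C\<close> by (intro mult_left_mono) auto
    also have "exp (- (\<epsilon> * (real k * \<omega>))) = q ^ k"
      by (simp add: q_def algebra_simps flip: exp_of_nat_mult)
    finally show ?thesis by (simp add: mult.assoc)
  qed
  have "0 \<le> q" "q < 1" using \<epsilon> \<omega> by (auto simp: q_def)
  then have "summable (\<lambda>k. real CARD('n) * C * q ^ k)"
    by (intro summable_mult summable_geometric) auto
  define l where "l t = (\<Sum>k. w (Suc k + N) t - w (k + N) t)" for t
  have "uniform_limit {- r..} (\<lambda>n t. \<Sum>k<n. w (Suc k + N) t - w (k + N) t) l sequentially"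
    unfolding l_def
    by (rule Weierstrass_m_test[OF step \<open>summable _\<close>])
  moreover have "(\<Sum>k<n. w (Suc k + N) t - w (k + N) t) = w (n + N) t - w N t" for n t
    using sum_lessThan_telescope[of "\<lambda>k. w (k + N) t" n] by simp
  ultimately have "uniform_limit {- r..} (\<lambda>n t. w (n + N) t - w N t) l sequentially"
    by simp
  from uniform_limit_add[OF this uniform_limit_const[where c = "w N"]]
  have lim: "uniform_limit {- r..} (\<lambda>n. w (n + N)) (\<lambda>t. l t + w N t) sequentially"
    by simp
  define v where "v t = l t + w N t" for t
  have pointwise: "(\<lambda>n. w (n + N) t) \<longlonglongrightarrow> v t" if "- r \<le> t" for t
    using tendsto_uniform_limitI[OF lim] that by (auto simp: v_def)
  have "sol v"
    using sol_uniform_limit[OF w lim] unfolding v_def .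
  moreover have "v (t + \<omega>) = v t" if "- r \<le> t" for t
  proof -
    have "(\<lambda>n. w (n + N) (t + \<omega>)) = (\<lambda>n. w (Suc n + N) t)"
      by (simp add: w_def algebra_simps)
    then have "(\<lambda>n. w (n + N) (t + \<omega>)) \<longlonglongrightarrow> v t"
      using LIMSEQ_Suc[OF pointwise[OF that]] by simp
    then show ?thesis
      using LIMSEQ_unique[OF pointwise] that \<omega> by auto
  qed
  ultimately show ?thesis by blast
qed

text \<open>Periodicity replaces \<open>v t\<close> by \<open>v (t + k \<omega>)\<close>, and the decay estimate applies as soon as
\<open>t + k \<omega> \<ge> 0\<close>, that is, for all large \<open>k\<close> even if \<open>t < 0\<close>.\<close>

lemma periodic_solution_attracts:
  assumes v: "sol v" and per: "\<And>t. - r \<le> t \<Longrightarrow> v (t + \<omega>) = v t"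
    and u: "sol u" and "- r \<le> t"
  shows "\<exists>C. \<forall>\<^sub>F k in sequentially.
    \<bar>u (t + real k * \<omega>) $ i - v t $ i\<bar> \<le> C * exp (- (real k * \<epsilon> * \<omega>))"
proof -
  have v_eq: "v (t + real k * \<omega>) = v t" for k
    using periodic_add_multiple[of v] per \<open>- r \<le> t\<close> by blast
  obtain C where C: "\<And>s. 0 \<le> s \<Longrightarrow> \<bar>u s $ i - v s $ i\<bar> \<le> C * exp (- (\<epsilon> * s))"
    using solutions_converge[OF u v] by blast
  obtain N :: nat where N: "r \<le> real N * \<omega>" using ex_multiple_period_ge_delay by blast
  have "\<bar>u (t + real k * \<omega>) $ i - v t $ i\<bar> \<le> C * exp (- (\<epsilon> * t)) * exp (- (real k * \<epsilon> * \<omega>))"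
    if "N \<le> k" for k
  proof -
    have "real N * \<omega> \<le> real k * \<omega>" using that \<omega> by simp
    then have "0 \<le> t + real k * \<omega>" using N \<open>- r \<le> t\<close> by simp
    from C[OF this] show ?thesis
      by (simp add: v_eq mult.assoc mult_exp_exp) (simp add: algebra_simps)
  qed
  then show ?thesis using eventually_sequentially by blast
qed

end

theorem theorem1:
  fixes p q \<omega> \<epsilon> :: real
    and d :: "'n::finite \<Rightarrow> real \<Rightarrow> real"
    and \<delta> :: "'n \<Rightarrow> real"
    and a b :: "'n \<Rightarrow> 'n \<Rightarrow> real \<Rightarrow> real"
    and I :: "'n \<Rightarrow> real \<Rightarrow> real"
    and \<tau> :: "'n \<Rightarrow> 'n \<Rightarrow> real"
    and g f :: "'n \<Rightarrow> real \<Rightarrow> real"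
    and G F \<xi> :: "'n \<Rightarrow> real"
    and \<alpha> \<beta> :: "'n \<Rightarrow> 'n \<Rightarrow> real"
  assumes "1 \<le> p" and "p \<noteq> 1 \<Longrightarrow> 1 / p + 1 / q = 1"
    and "\<omega> > 0"
    and "\<And>i j. \<tau> i j \<ge> 0"
    and "\<And>i. periodic_coeff \<omega> (d i)"
    and "\<And>i j. periodic_coeff \<omega> (a i j)"
    and "\<And>i j. periodic_coeff \<omega> (b i j)"
    and "\<And>i. periodic_coeff \<omega> (I i)"
    and "\<And>i. \<delta> i > 0" and "\<And>i t. t \<ge> 0 \<Longrightarrow> d i t \<ge> \<delta> i"
    and "\<And>i. G i > 0" and "H_class G g"
    and "\<And>i. F i > 0" and "H_class F f"
    and "\<epsilon> > 0" and "\<And>i. \<xi> i > 0"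
    and "((p = 1 \<longrightarrow> (\<forall>i j. \<alpha> i j = 1 \<and> \<beta> i j = 1)) \<and>
          (\<forall>i. stability_lhs p q \<delta> (\<lambda>i j. sup_abs \<omega> (a i j)) (\<lambda>i j. sup_abs \<omega> (b i j))
                 \<tau> G F \<epsilon> \<xi> \<alpha> \<beta> i \<le> 0))
       \<or> (\<forall>i. stability_lhs_special p q \<delta> (\<lambda>i j. sup_abs \<omega> (a i j)) (\<lambda>i j. sup_abs \<omega> (b i j))
                 \<tau> G F \<epsilon> \<xi> i \<le> 0)"
  shows "\<exists>v. periodic_solution \<omega> d a b I \<tau> g f v
           \<and> (\<forall>w. periodic_solution \<omega> d a b I \<tau> g f w \<longrightarrow> (\<forall>t\<ge>- max_delay \<tau>. w t = v t))
           \<and> (\<forall>u. solution d a b I \<tau> g f u \<longrightarrow>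
                (\<forall>i. \<forall>t\<ge>- max_delay \<tau>.
                   (\<lambda>k::nat. \<bar>u (t + real k * \<omega>) $ i - v t $ i\<bar>)
                     \<in> O(\<lambda>k. exp (- (real k * \<epsilon> * \<omega>)))))"
proof -
  interpret periodic_delay_system \<omega> d a b I \<tau> g f G F
    by (rule periodic_delay_system.intro) (fact assms(3-8,12,14))+
  obtain \<alpha>' \<beta>' where exps: "\<And>i j. p = 1 \<Longrightarrow> \<alpha>' i j = 1" "\<And>i j. p = 1 \<Longrightarrow> \<beta>' i j = 1"
    and stab: "\<And>i. stability_lhs p q \<delta> A B \<tau> G F \<epsilon> \<xi> \<alpha>' \<beta>' i \<le> 0"
    using assms(17)
  proof
    assume "\<forall>i. stability_lhs_special p q \<delta> A B \<tau> G F \<epsilon> \<xi> i \<le> 0"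
    then show thesis
      using that[of "\<lambda>_ _. 1 / p" "\<lambda>_ _. 1 / p"]
        stability_lhs_special_eq[where A = A and B = B, OF assms(1,2) A_nonneg B_nonneg]
      by simp
  next
    assume general: "(p = 1 \<longrightarrow> (\<forall>i j. \<alpha> i j = 1 \<and> \<beta> i j = 1)) \<and>
      (\<forall>i. stability_lhs p q \<delta> A B \<tau> G F \<epsilon> \<xi> \<alpha> \<beta> i \<le> 0)"
    show thesis by (rule that[of \<alpha> \<beta>]) (simp_all add: general)
  qed
  then interpret stable_delay_system \<omega> d a b I \<tau> g f G F p q \<epsilon> \<delta> \<xi> \<alpha>' \<beta>'
  proof (intro stable_delay_system.intro periodic_delay_system_axioms)
    show "stable_delay_system_axioms \<omega> d a b \<tau> G F p q \<epsilon> \<delta> \<xi> \<alpha>' \<beta>'"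
      by (rule stable_delay_system_axioms.intro) (fact assms(1,2,15,16,10) exps stab)+
  qed
  obtain v where v: "sol v" "\<And>t. - r \<le> t \<Longrightarrow> v (t + \<omega>) = v t"
    using ex_periodic_solution by blast
  \<comment> \<open>both solutions are periodic, so their difference at \<open>t\<close> is that at \<open>t + k \<omega>\<close>, which tends to \<open>0\<close>\<close>
  have "w t = v t" if w: "periodic_solution \<omega> d a b I \<tau> g f w" and t: "- r \<le> t" for w t
  proof (rule vec_eq_iff[THEN iffD2], rule allI)
    fix i
    have "sol w" and w_per: "\<And>t. - r \<le> t \<Longrightarrow> w (t + \<omega>) = w t"
      using w by (auto simp: periodic_solution_def)
    have w_eq: "w (t + real k * \<omega>) = w t" for k
      using periodic_add_multiple[of w] w_per t by blast
    obtain C where C: "\<forall>\<^sub>F k in sequentially.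
        \<bar>w (t + real k * \<omega>) $ i - v t $ i\<bar> \<le> C * exp (- (real k * \<epsilon> * \<omega>))"
      using periodic_solution_attracts[OF v \<open>sol w\<close> t] by blast
    have "(\<lambda>k. C * exp (- (\<epsilon> * \<omega>)) ^ k) \<longlonglongrightarrow> 0"
      using \<epsilon> \<omega> by (intro tendsto_mult_right_zero LIMSEQ_power_zero) simp
    moreover have "exp (- (\<epsilon> * \<omega>)) ^ k = exp (- (real k * \<epsilon> * \<omega>))" for k
      by (simp add: algebra_simps flip: exp_of_nat_mult)
    ultimately have "(\<lambda>k. C * exp (- (real k * \<epsilon> * \<omega>))) \<longlonglongrightarrow> 0"
      by simp
    from tendsto_lowerbound[OF this C[unfolded w_eq]] show "w t $ i = v t $ i"
      by simp
  qed
  moreover have "(\<lambda>k. \<bar>u (t + real k * \<omega>) $ i - v t $ i\<bar>) \<in> O(\<lambda>k. exp (- (real k * \<epsilon> * \<omega>)))"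
    if "sol u" "- r \<le> t" for u i t
    using periodic_solution_attracts[OF v that, of i] by (auto intro: bigoI)
  ultimately show ?thesis
    using v by (intro exI[of _ v]) (auto simp: periodic_solution_def)
qed

end
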